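(* Let $(R,\mathfrak{m})$ be a noetherian local ring and let $M$ be an $R$-module. If there exists an (arbitrary) $R$-module monomorphism $M^{\circ\circ}\hookrightarrow M$ or an (arbitrary) $R$-module epimorphism $M\twoheadrightarrow M^{\circ\circ}$, then $M$ is (Matlis-)reflexive.
   Context: Rings are commutative with unit. $(R,\mathfrak{m})$ is a noetherian local ring with residue field $k=R/\mathfrak{m}$, and $E$ is the injective hull of $k$ as an $R$-module. For an $R$-module $M$ (not assumed finitely generated), $M^\circ=\operatorname{Hom}_R(M,E)$ is the Matlis dual, $M^{\circ\circ}=(M^\circ)^\circ$, and $\varphi:M\to M^{\circ\circ}$, $\varphi(x)(f)=f(x)$, is the canonical map, which is always injective. $M$ is called (Matlis-)reflexive if $\varphi$ is surjective. *)

theory Defs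
  imports "HOL-Algebra.Module" "HOL-Algebra.Ring_Divisibility"
begin

locale noetherian_local_ring = noetherian_ring R + cring R for R (structure) +
  fixes \<mm> :: "'a set"
  assumes maximal: "maximalideal \<mm> R"
    and maximal_unique: "maximalideal J R \<Longrightarrow> J = \<mm>"

text \<open>Only the additive group and the scalar multiplication of a \<open>module\<close> record matter;
  the fields \<open>mult\<close> and \<open>one\<close>, which the record type inherits from rings, carry no information.\<close>

definition ring_module :: "('r, 'c) ring_scheme \<Rightarrow> ('r, 'r) module"
  where "ring_module R =
    \<lparr>carrier = carrier R, mult = mult R, one = \<one>\<^bsub>R\<^esub>, zero = \<zero>\<^bsub>R\<^esub>, add = add R,
     smult = mult R\<rparr>"

definition residue_module :: "('r, 'c) ring_scheme \<Rightarrow> 'r set \<Rightarrow> ('r, 'r set) module"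
  where "residue_module R I =
    \<lparr>carrier = carrier (R Quot I), mult = mult (R Quot I), one = \<one>\<^bsub>R Quot I\<^esub>,
     zero = \<zero>\<^bsub>R Quot I\<^esub>, add = add (R Quot I),
     smult = (\<lambda>r X. (I +>\<^bsub>R\<^esub> r) \<otimes>\<^bsub>R Quot I\<^esub> X)\<rparr>"

text \<open>Homomorphisms are extensional, so that equality of functions is equality of homomorphisms.\<close>

definition mod_hom ::
    "('r, 'c) ring_scheme \<Rightarrow> ('r, 'a, 'd) module_scheme \<Rightarrow> ('r, 'b, 'e) module_scheme \<Rightarrow> ('a \<Rightarrow> 'b) set"
  where "mod_hom R A B =
    {f \<in> carrier A \<rightarrow>\<^sub>E carrier B.
       (\<forall>x\<in>carrier A. \<forall>y\<in>carrier A. f (x \<oplus>\<^bsub>A\<^esub> y) = f x \<oplus>\<^bsub>B\<^esub> f y) \<and>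
       (\<forall>r\<in>carrier R. \<forall>x\<in>carrier A. f (r \<odot>\<^bsub>A\<^esub> x) = r \<odot>\<^bsub>B\<^esub> f x)}"

definition mod_mono ::
    "('r, 'c) ring_scheme \<Rightarrow> ('r, 'a, 'd) module_scheme \<Rightarrow> ('r, 'b, 'e) module_scheme \<Rightarrow> ('a \<Rightarrow> 'b) set"
  where "mod_mono R A B = {f \<in> mod_hom R A B. inj_on f (carrier A)}"

definition mod_epi ::
    "('r, 'c) ring_scheme \<Rightarrow> ('r, 'a, 'd) module_scheme \<Rightarrow> ('r, 'b, 'e) module_scheme \<Rightarrow> ('a \<Rightarrow> 'b) set"
  where "mod_epi R A B = {f \<in> mod_hom R A B. f ` carrier A = carrier B}"

definition Hom_module ::
    "('r, 'c) ring_scheme \<Rightarrow> ('r, 'a, 'd) module_scheme \<Rightarrow> ('r, 'b, 'e) module_scheme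
      \<Rightarrow> ('r, 'a \<Rightarrow> 'b) module"
  where "Hom_module R A B =
    \<lparr>carrier = mod_hom R A B, mult = undefined, one = undefined,
     zero = (\<lambda>x\<in>carrier A. \<zero>\<^bsub>B\<^esub>),
     add = (\<lambda>f g. \<lambda>x\<in>carrier A. f x \<oplus>\<^bsub>B\<^esub> g x),
     smult = (\<lambda>r f. \<lambda>x\<in>carrier A. r \<odot>\<^bsub>B\<^esub> f x)\<rparr>"

text \<open>A definition cannot quantify over types, so the test modules \<open>A\<close> and \<open>B\<close> live on the type of
  the ring elements.  This is no restriction: the ideals of \<open>R\<close> and \<open>R\<close> itself are among them,
  and by Baer's argument the extension property then holds for modules over arbitrary types
  (\<open>injective_module_extend\<close> below).\<close>

definition injective_module :: "('r, 'c) ring_scheme \<Rightarrow> ('r, 'e, 'd) module_scheme \<Rightarrow> bool"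
  where "injective_module R E \<longleftrightarrow> module R E \<and>
    (\<forall>(A :: ('r, 'r) module) (B :: ('r, 'r) module). module R A \<longrightarrow> module R B \<longrightarrow>
      (\<forall>f \<in> mod_mono R A B. \<forall>g \<in> mod_hom R A E.
         \<exists>h \<in> mod_hom R B E. \<forall>x \<in> carrier A. h (f x) = g x))"

definition essential_in ::
    "'e set \<Rightarrow> ('r, 'c) ring_scheme \<Rightarrow> ('r, 'e, 'd) module_scheme \<Rightarrow> bool"
  where "essential_in N R E \<longleftrightarrow> submodule N R E \<and>
    (\<forall>L. submodule L R E \<longrightarrow> L \<noteq> {\<zero>\<^bsub>E\<^esub>} \<longrightarrow> L \<inter> N \<noteq> {\<zero>\<^bsub>E\<^esub>})"

definition injective_hull ::
    "('r, 'c) ring_scheme \<Rightarrow> ('r, 'k, 'd) module_scheme \<Rightarrow> ('r, 'e, 'f) module_scheme \<Rightarrow> bool"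
  where "injective_hull R K E \<longleftrightarrow> injective_module R E \<and>
    (\<exists>i \<in> mod_mono R K E. essential_in (i ` carrier K) R E)"

abbreviation matlis_dual ::
    "('r, 'c) ring_scheme \<Rightarrow> ('r, 'e, 'd) module_scheme \<Rightarrow> ('r, 'm, 'f) module_scheme
      \<Rightarrow> ('r, 'm \<Rightarrow> 'e) module"
  where "matlis_dual R E M \<equiv> Hom_module R M E"

abbreviation matlis_bidual ::
    "('r, 'c) ring_scheme \<Rightarrow> ('r, 'e, 'd) module_scheme \<Rightarrow> ('r, 'm, 'f) module_scheme
      \<Rightarrow> ('r, ('m \<Rightarrow> 'e) \<Rightarrow> 'e) module"
  where "matlis_bidual R E M \<equiv> matlis_dual R E (matlis_dual R E M)"

definition canonical_map ::
    "('r, 'c) ring_scheme \<Rightarrow> ('r, 'e, 'd) module_scheme \<Rightarrow> ('r, 'm, 'f) module_scheme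
      \<Rightarrow> 'm \<Rightarrow> ('m \<Rightarrow> 'e) \<Rightarrow> 'e"
  where "canonical_map R E M =
    (\<lambda>x\<in>carrier M. \<lambda>f\<in>carrier (matlis_dual R E M). f x)"

definition matlis_reflexive ::
    "('r, 'c) ring_scheme \<Rightarrow> ('r, 'e, 'd) module_scheme \<Rightarrow> ('r, 'm, 'f) module_scheme \<Rightarrow> bool"
  where "matlis_reflexive R E M \<longleftrightarrow>
    canonical_map R E M ` carrier M = carrier (matlis_bidual R E M)"

section \<open>Well-definedness\<close>

lemma mod_homD:
  assumes "f \<in> mod_hom R A B"
  shows "\<And>x. x \<in> carrier A \<Longrightarrow> f x \<in> carrier B"
    and "\<And>x y. x \<in> carrier A \<Longrightarrow> y \<in> carrier A \<Longrightarrow> f (x \<oplus>\<^bsub>A\<^esub> y) = f x \<oplus>\<^bsub>B\<^esub> f y"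
    and "\<And>r x. r \<in> carrier R \<Longrightarrow> x \<in> carrier A \<Longrightarrow> f (r \<odot>\<^bsub>A\<^esub> x) = r \<odot>\<^bsub>B\<^esub> f x"
    and "f \<in> extensional (carrier A)"
  using assms by (auto simp: mod_hom_def PiE_def)

lemma mod_homI:
  assumes "\<And>x. x \<in> carrier A \<Longrightarrow> f x \<in> carrier B"
    and "\<And>x y. x \<in> carrier A \<Longrightarrow> y \<in> carrier A \<Longrightarrow> f (x \<oplus>\<^bsub>A\<^esub> y) = f x \<oplus>\<^bsub>B\<^esub> f y"
    and "\<And>r x. r \<in> carrier R \<Longrightarrow> x \<in> carrier A \<Longrightarrow> f (r \<odot>\<^bsub>A\<^esub> x) = r \<odot>\<^bsub>B\<^esub> f x"
    and "f \<in> extensional (carrier A)"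
  shows "f \<in> mod_hom R A B"
  using assms by (auto simp: mod_hom_def PiE_def)

lemma abelian_group_cong:
  assumes "abelian_group A" "carrier B = carrier A" "add B = add A" "zero B = zero A"
  shows "abelian_group B"
proof -
  interpret A: abelian_group A by fact
  show ?thesis
    by (rule abelian_groupI) (auto simp: assms(2-) A.a_ac intro: A.l_neg)
qed

lemma ring_module_is_module:
  assumes "cring R" shows "module R (ring_module R)"
proof -
  interpret cring R by fact
  have "abelian_group (ring_module R)"
    by (rule abelian_group_cong[OF is_abelian_group]) (auto simp: ring_module_def)
  then show ?thesis
    by (intro moduleI assms) (auto simp: ring_module_def l_distr r_distr m_assoc)
qed

lemma residue_module_is_module:
  assumes "cring R" "ideal I R" shows "module R (residue_module R I)"
proof -
  interpret R: cring R by fact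
  interpret I: ideal I R by fact
  interpret Q: cring "R Quot I" by (rule I.quotient_is_cring[OF assms(1)])
  have h: "(+>\<^bsub>R\<^esub>) I \<in> ring_hom R (R Quot I)" by (rule I.rcos_ring_hom)
  note hs = ring_hom_closed[OF h] ring_hom_add[OF h] ring_hom_mult[OF h] ring_hom_one[OF h]
  have "abelian_group (residue_module R I)"
    by (rule abelian_group_cong[OF Q.is_abelian_group]) (auto simp: residue_module_def)
  then show ?thesis
    by (intro moduleI assms) (auto simp: residue_module_def hs Q.l_distr Q.r_distr Q.m_assoc)
qed

lemma Hom_module_is_module:
  assumes "module R A" "module R B" shows "module R (Hom_module R A B)"
proof -
  interpret A: module R A by fact
  interpret B: module R B by fact
  have ext: "f = g" if "f \<in> extensional (carrier A)" "g \<in> extensional (carrier A)"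
    "\<And>x. x \<in> carrier A \<Longrightarrow> f x = g x" for f g :: "'c \<Rightarrow> 'e"
    using that by (rule extensionalityI)
  have add: "(\<lambda>x\<in>carrier A. f x \<oplus>\<^bsub>B\<^esub> g x) \<in> mod_hom R A B"
    if "f \<in> mod_hom R A B" "g \<in> mod_hom R A B" for f g
    using mod_homD[OF that(1)] mod_homD[OF that(2)]
    by (intro mod_homI) (auto simp: B.smult_r_distr B.M.a_ac)
  have zero: "(\<lambda>x\<in>carrier A. \<zero>\<^bsub>B\<^esub>) \<in> mod_hom R A B"
    by (intro mod_homI) auto
  have smult: "(\<lambda>x\<in>carrier A. r \<odot>\<^bsub>B\<^esub> f x) \<in> mod_hom R A B"
    if "f \<in> mod_hom R A B" "r \<in> carrier R" for r f
    using mod_homD[OF that(1)] that(2)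
    by (intro mod_homI)
      (auto simp: B.smult_r_distr B.smult_assoc1[symmetric] A.R.m_comm)
  let ?H = "Hom_module R A B"
  have "abelian_group ?H"
  proof (rule abelian_groupI)
    fix f g assume "f \<in> carrier ?H" "g \<in> carrier ?H"
    then have fg: "f \<in> mod_hom R A B" "g \<in> mod_hom R A B" by (simp_all add: Hom_module_def)
    show "f \<oplus>\<^bsub>?H\<^esub> g \<in> carrier ?H" using add[OF fg] by (simp add: Hom_module_def)
    show "f \<oplus>\<^bsub>?H\<^esub> g = g \<oplus>\<^bsub>?H\<^esub> f"
      by (simp add: Hom_module_def mod_homD(1)[OF fg(1)] mod_homD(1)[OF fg(2)] B.M.a_comm cong: restrict_cong)
  next
    fix f g h assume "f \<in> carrier ?H" "g \<in> carrier ?H" "h \<in> carrier ?H"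
    then have fgh: "f \<in> mod_hom R A B" "g \<in> mod_hom R A B" "h \<in> mod_hom R A B"
      by (simp_all add: Hom_module_def)
    show "f \<oplus>\<^bsub>?H\<^esub> g \<oplus>\<^bsub>?H\<^esub> h = f \<oplus>\<^bsub>?H\<^esub> (g \<oplus>\<^bsub>?H\<^esub> h)"
      by (simp add: Hom_module_def mod_homD(1)[OF fgh(1)] mod_homD(1)[OF fgh(2)]
          mod_homD(1)[OF fgh(3)] B.M.a_assoc cong: restrict_cong)
  next
    fix f assume "f \<in> carrier ?H"
    then have f: "f \<in> mod_hom R A B" by (simp add: Hom_module_def)
    show "\<zero>\<^bsub>?H\<^esub> \<oplus>\<^bsub>?H\<^esub> f = f"
      by (rule ext) (simp_all add: Hom_module_def mod_homD(1,4)[OF f])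
    let ?g = "\<lambda>x\<in>carrier A. (\<ominus>\<^bsub>R\<^esub> \<one>\<^bsub>R\<^esub>) \<odot>\<^bsub>B\<^esub> f x"
    have "?g \<in> mod_hom R A B" by (rule smult[OF f]) simp
    moreover have "(\<lambda>x\<in>carrier A. ?g x \<oplus>\<^bsub>B\<^esub> f x) = (\<lambda>x\<in>carrier A. \<zero>\<^bsub>B\<^esub>)"
      by (rule ext) (simp_all add: B.smult_l_minus B.M.l_neg mod_homD(1)[OF f])
    ultimately show "\<exists>g\<in>carrier ?H. g \<oplus>\<^bsub>?H\<^esub> f = \<zero>\<^bsub>?H\<^esub>"
      by (intro bexI[of _ ?g]) (simp_all add: Hom_module_def)
  qed (simp add: Hom_module_def zero)
  then show ?thesis
  proof (intro moduleI A.R.is_cring)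
    fix r f assume r: "r \<in> carrier R" and "f \<in> carrier ?H"
    then have f: "f \<in> mod_hom R A B" by (simp add: Hom_module_def)
    note D = mod_homD(1)[OF f]
    show "r \<odot>\<^bsub>?H\<^esub> f \<in> carrier ?H" using smult[OF f r] by (simp add: Hom_module_def)
    show "(r \<oplus>\<^bsub>R\<^esub> s) \<odot>\<^bsub>?H\<^esub> f = r \<odot>\<^bsub>?H\<^esub> f \<oplus>\<^bsub>?H\<^esub> s \<odot>\<^bsub>?H\<^esub> f" if "s \<in> carrier R" for s
      by (simp add: Hom_module_def D r that B.smult_l_distr cong: restrict_cong)
    show "(r \<otimes>\<^bsub>R\<^esub> s) \<odot>\<^bsub>?H\<^esub> f = r \<odot>\<^bsub>?H\<^esub> (s \<odot>\<^bsub>?H\<^esub> f)" if "s \<in> carrier R" for s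
      by (simp add: Hom_module_def D r that B.smult_assoc1 cong: restrict_cong)
    show "r \<odot>\<^bsub>?H\<^esub> (f \<oplus>\<^bsub>?H\<^esub> g) = r \<odot>\<^bsub>?H\<^esub> f \<oplus>\<^bsub>?H\<^esub> r \<odot>\<^bsub>?H\<^esub> g" if "g \<in> carrier ?H" for g
    proof -
      have "g \<in> mod_hom R A B" using that by (simp add: Hom_module_def)
      then show ?thesis
        by (simp add: Hom_module_def D r mod_homD(1) B.smult_r_distr cong: restrict_cong)
    qed
  next
    fix f assume "f \<in> carrier ?H"
    then have f: "f \<in> mod_hom R A B" by (simp add: Hom_module_def)
    show "\<one>\<^bsub>R\<^esub> \<odot>\<^bsub>?H\<^esub> f = f"
      by (rule ext) (simp_all add: Hom_module_def mod_homD(1,4)[OF f])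
  qed
qed

lemma canonical_map_hom:
  assumes "module R M" "module R E"
  shows "canonical_map R E M \<in> mod_hom R M (matlis_bidual R E M)"
proof -
  interpret M: module R M by fact
  interpret E: module R E by fact
  interpret D: module R "Hom_module R M E" by (rule Hom_module_is_module) fact+
  let ?D = "Hom_module R M E"
  have c: "f \<in> carrier ?D \<longleftrightarrow> f \<in> mod_hom R M E" for f
    by (simp add: Hom_module_def)
  have "(\<lambda>f\<in>mod_hom R M E. f x) \<in> mod_hom R ?D E" if "x \<in> carrier M" for x
  proof (rule mod_homI)
    fix f g assume "f \<in> carrier ?D" "g \<in> carrier ?D"
    then have "f \<oplus>\<^bsub>?D\<^esub> g \<in> mod_hom R M E" "f \<in> mod_hom R M E" "g \<in> mod_hom R M E"
      using D.M.add.m_closed c by blast+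
    then show "(\<lambda>f\<in>mod_hom R M E. f x) (f \<oplus>\<^bsub>?D\<^esub> g) =
        (\<lambda>f\<in>mod_hom R M E. f x) f \<oplus>\<^bsub>E\<^esub> (\<lambda>f\<in>mod_hom R M E. f x) g"
      using that by (simp add: Hom_module_def)
  next
    fix r f assume "r \<in> carrier R" "f \<in> carrier ?D"
    then have "r \<odot>\<^bsub>?D\<^esub> f \<in> mod_hom R M E" "f \<in> mod_hom R M E"
      using D.smult_closed c by blast+
    then show "(\<lambda>f\<in>mod_hom R M E. f x) (r \<odot>\<^bsub>?D\<^esub> f) = r \<odot>\<^bsub>E\<^esub> (\<lambda>f\<in>mod_hom R M E. f x) f"
      using that by (simp add: Hom_module_def)
  qed (simp_all add: Hom_module_def mod_homD(1)[OF _ that])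
  note ev = this
  show ?thesis
  proof (rule mod_homI)
    fix x y assume "x \<in> carrier M" "y \<in> carrier M"
    then show "canonical_map R E M (x \<oplus>\<^bsub>M\<^esub> y) =
        canonical_map R E M x \<oplus>\<^bsub>matlis_bidual R E M\<^esub> canonical_map R E M y"
      by (simp add: canonical_map_def Hom_module_def mod_homD(2) cong: restrict_cong)
  next
    fix r x assume "r \<in> carrier R" "x \<in> carrier M"
    then show "canonical_map R E M (r \<odot>\<^bsub>M\<^esub> x) =
        r \<odot>\<^bsub>matlis_bidual R E M\<^esub> canonical_map R E M x"
      by (simp add: canonical_map_def Hom_module_def mod_homD(3) cong: restrict_cong)
  next
    fix x assume "x \<in> carrier M"
    then show "canonical_map R E M x \<in> carrier (matlis_bidual R E M)"
      using ev[of x] by (simp add: canonical_map_def Hom_module_def)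
  qed (simp add: canonical_map_def)
qed

section \<open>Injectivity with respect to modules over arbitrary types\<close>

lemma injective_module_ideal:
  assumes "injective_module R E" "cring R" "ideal I R"
    and hE: "\<And>r. r \<in> I \<Longrightarrow> h r \<in> carrier E"
    and hadd: "\<And>r s. r \<in> I \<Longrightarrow> s \<in> I \<Longrightarrow> h (r \<oplus>\<^bsub>R\<^esub> s) = h r \<oplus>\<^bsub>E\<^esub> h s"
    and hmult: "\<And>r s. r \<in> carrier R \<Longrightarrow> s \<in> I \<Longrightarrow> h (r \<otimes>\<^bsub>R\<^esub> s) = r \<odot>\<^bsub>E\<^esub> h s"
  shows "\<exists>e\<in>carrier E. \<forall>r\<in>I. h r = r \<odot>\<^bsub>E\<^esub> e"
proof -
  interpret R: cring R by fact
  interpret I: ideal I R by fact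
  interpret RM: module R "ring_module R" by (rule ring_module_is_module) fact
  let ?A = "(ring_module R)\<lparr>carrier := I\<rparr>"
  have neg: "\<ominus>\<^bsub>ring_module R\<^esub> a \<in> I" if "a \<in> I" for a
  proof -
    have "\<ominus>\<^bsub>ring_module R\<^esub> a = (\<ominus>\<^bsub>R\<^esub> \<one>\<^bsub>R\<^esub>) \<odot>\<^bsub>ring_module R\<^esub> a"
      using RM.smult_l_minus[of "\<one>\<^bsub>R\<^esub>" a] RM.smult_one[of a] I.a_Hcarr[OF that]
      by (simp add: ring_module_def)
    then show ?thesis using that by (simp add: ring_module_def I.I_l_closed)
  qed
  have sub: "submodule I R (ring_module R)"
    by (rule RM.submoduleI[OF _ _ neg])
      (simp_all add: ring_module_def I.a_subset I.I_l_closed additive_subgroup.a_closed[OF I.additive_subgroup_axioms]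
        additive_subgroup.zero_closed[OF I.additive_subgroup_axioms])
  have A: "module R ?A"
    by (rule submodule.submodule_is_module[OF sub RM.module_axioms])
  have i: "(\<lambda>x\<in>I. x) \<in> mod_mono R ?A (ring_module R)"
    unfolding mod_mono_def
    by (auto intro!: mod_homI simp: ring_module_def I.a_Hcarr I.I_l_closed inj_on_def)
  have g: "restrict h I \<in> mod_hom R ?A E"
    by (rule mod_homI) (auto simp: ring_module_def hE hadd hmult I.I_l_closed)
  obtain k where k: "k \<in> mod_hom R (ring_module R) E" "\<And>x. x \<in> I \<Longrightarrow> k x = h x"
    using assms(1) A RM.module_axioms i g unfolding injective_module_def by fastforce
  have "h r = r \<odot>\<^bsub>E\<^esub> k \<one>\<^bsub>R\<^esub>" if "r \<in> I" for r
    using mod_homD(3)[OF k(1), of r "\<one>\<^bsub>R\<^esub>"] k(2)[OF that] that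
    by (simp add: ring_module_def I.a_Hcarr)
  moreover have "k \<one>\<^bsub>R\<^esub> \<in> carrier E"
    using mod_homD(1)[OF k(1)] by (simp add: ring_module_def)
  ultimately show ?thesis by blast
qed

theorem injective_module_extend:
  fixes A :: "('r, 'a, 'd) module_scheme" and B :: "('r, 'b, 'f) module_scheme"
  assumes inj: "injective_module R E" and "module R A" "module R B"
    and f: "f \<in> mod_mono R A B" and g: "g \<in> mod_hom R A E"
  shows "\<exists>h \<in> mod_hom R B E. \<forall>x \<in> carrier A. h (f x) = g x"
proof -
  interpret A: module R A by fact
  interpret B: module R B by fact
  interpret E: module R E using inj by (simp add: injective_module_def)
  have fh: "f \<in> mod_hom R A B" and finj: "inj_on f (carrier A)"
    using f by (auto simp: mod_mono_def)
  define P where "P G \<longleftrightarrow> G \<subseteq> carrier B \<times> carrier E \<and> (\<lambda>a. (f a, g a)) ` carrier A \<subseteq> G \<and>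
    (\<forall>b e e'. (b, e) \<in> G \<longrightarrow> (b, e') \<in> G \<longrightarrow> e = e') \<and>
    (\<forall>b e b' e'. (b, e) \<in> G \<longrightarrow> (b', e') \<in> G \<longrightarrow> (b \<oplus>\<^bsub>B\<^esub> b', e \<oplus>\<^bsub>E\<^esub> e') \<in> G) \<and>
    (\<forall>r b e. r \<in> carrier R \<longrightarrow> (b, e) \<in> G \<longrightarrow> (r \<odot>\<^bsub>B\<^esub> b, r \<odot>\<^bsub>E\<^esub> e) \<in> G)" for G
  have Psub: "G \<subseteq> carrier B \<times> carrier E"
    and Pfg: "(\<lambda>a. (f a, g a)) ` carrier A \<subseteq> G"
    and Puniq: "\<And>b e e'. (b, e) \<in> G \<Longrightarrow> (b, e') \<in> G \<Longrightarrow> e = e'"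
    and Padd: "\<And>b e b' e'. (b, e) \<in> G \<Longrightarrow> (b', e') \<in> G \<Longrightarrow> (b \<oplus>\<^bsub>B\<^esub> b', e \<oplus>\<^bsub>E\<^esub> e') \<in> G"
    and Psmult: "\<And>r b e. r \<in> carrier R \<Longrightarrow> (b, e) \<in> G \<Longrightarrow> (r \<odot>\<^bsub>B\<^esub> b, r \<odot>\<^bsub>E\<^esub> e) \<in> G"
    if "P G" for G
  proof -
    note Q = that[unfolded P_def]
    show "G \<subseteq> carrier B \<times> carrier E" by (rule Q[THEN conjunct1])
    show "(\<lambda>a. (f a, g a)) ` carrier A \<subseteq> G" by (rule Q[THEN conjunct2, THEN conjunct1])
    show "e = e'" if "(b, e) \<in> G" "(b, e') \<in> G" for b e e'
      by (rule Q[THEN conjunct2, THEN conjunct2, THEN conjunct1, rule_format, OF that])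
    show "(b \<oplus>\<^bsub>B\<^esub> b', e \<oplus>\<^bsub>E\<^esub> e') \<in> G" if "(b, e) \<in> G" "(b', e') \<in> G" for b e b' e'
      by (rule Q[THEN conjunct2, THEN conjunct2, THEN conjunct2, THEN conjunct1, rule_format, OF that])
    show "(r \<odot>\<^bsub>B\<^esub> b, r \<odot>\<^bsub>E\<^esub> e) \<in> G" if "r \<in> carrier R" "(b, e) \<in> G" for r b e
      by (rule Q[THEN conjunct2, THEN conjunct2, THEN conjunct2, THEN conjunct2, rule_format, OF that])
  qed
  have "P ((\<lambda>a. (f a, g a)) ` carrier A)"
    unfolding P_def
  proof (intro conjI allI impI)
    show "(\<lambda>a. (f a, g a)) ` carrier A \<subseteq> carrier B \<times> carrier E"
      using mod_homD(1)[OF fh] mod_homD(1)[OF g] by auto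
  next
    fix b e e' assume "(b, e) \<in> (\<lambda>a. (f a, g a)) ` carrier A" "(b, e') \<in> (\<lambda>a. (f a, g a)) ` carrier A"
    then show "e = e'" using finj by (auto simp: inj_on_def)
  next
    fix b e b' e' assume "(b, e) \<in> (\<lambda>a. (f a, g a)) ` carrier A" "(b', e') \<in> (\<lambda>a. (f a, g a)) ` carrier A"
    then obtain a a' where "a \<in> carrier A" "a' \<in> carrier A" "b = f a" "e = g a" "b' = f a'" "e' = g a'"
      by auto
    then show "(b \<oplus>\<^bsub>B\<^esub> b', e \<oplus>\<^bsub>E\<^esub> e') \<in> (\<lambda>a. (f a, g a)) ` carrier A"
      by (intro image_eqI[of _ _ "a \<oplus>\<^bsub>A\<^esub> a'"]) (auto simp: mod_homD[OF fh] mod_homD[OF g])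
  next
    fix r b e assume r: "r \<in> carrier R" and "(b, e) \<in> (\<lambda>a. (f a, g a)) ` carrier A"
    then obtain a where "a \<in> carrier A" "b = f a" "e = g a"
      by auto
    then show "(r \<odot>\<^bsub>B\<^esub> b, r \<odot>\<^bsub>E\<^esub> e) \<in> (\<lambda>a. (f a, g a)) ` carrier A"
      using r by (intro image_eqI[of _ _ "r \<odot>\<^bsub>A\<^esub> a"]) (auto simp: mod_homD[OF fh] mod_homD[OF g])
  qed simp
  then have ne: "{G. P G} \<noteq> {}" by blast
  have chain: "\<Union>C \<in> {G. P G}" if "C \<noteq> {}" "subset.chain {G. P G} C" for C
  proof -
    have CP: "P G" if "G \<in> C" for G
      using that \<open>subset.chain _ C\<close> by (auto simp: subset.chain_def)
    have two: "\<exists>G\<in>C. p \<in> G \<and> q \<in> G" if pq: "p \<in> \<Union>C" "q \<in> \<Union>C" for p q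
    proof -
      obtain X Y where "X \<in> C" "p \<in> X" "Y \<in> C" "q \<in> Y" using pq by blast
      moreover from this have "X \<subseteq> Y \<or> Y \<subseteq> X"
        using \<open>subset.chain _ C\<close> by (auto simp: subset_chain_def)
      ultimately show ?thesis by blast
    qed
    show ?thesis unfolding mem_Collect_eq P_def
    proof (intro conjI allI impI)
      show "\<Union>C \<subseteq> carrier B \<times> carrier E" using Psub[OF CP] by blast
      show "(\<lambda>a. (f a, g a)) ` carrier A \<subseteq> \<Union>C" using Pfg[OF CP] \<open>C \<noteq> {}\<close> by blast
    next
      fix b e e' assume "(b, e) \<in> \<Union>C" "(b, e') \<in> \<Union>C"
      from two[OF this] obtain G where "G \<in> C" "(b, e) \<in> G" "(b, e') \<in> G" by blast
      then show "e = e'" using Puniq[OF CP] by blast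
    next
      fix b e b' e' assume "(b, e) \<in> \<Union>C" "(b', e') \<in> \<Union>C"
      from two[OF this] obtain G where "G \<in> C" "(b, e) \<in> G" "(b', e') \<in> G" by blast
      then show "(b \<oplus>\<^bsub>B\<^esub> b', e \<oplus>\<^bsub>E\<^esub> e') \<in> \<Union>C" using Padd[OF CP] by blast
    next
      fix r b e assume r: "r \<in> carrier R" and "(b, e) \<in> \<Union>C"
      then obtain G where "G \<in> C" "(b, e) \<in> G" by blast
      then show "(r \<odot>\<^bsub>B\<^esub> b, r \<odot>\<^bsub>E\<^esub> e) \<in> \<Union>C" using Psmult[OF CP r] by blast
    qed
  qed
  obtain G where PG: "P G" and max: "\<And>G'. P G' \<Longrightarrow> G \<subseteq> G' \<Longrightarrow> G' = G"
    using subset_Zorn_nonempty[OF ne chain] by auto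
  have Gsub: "b \<in> carrier B \<and> e \<in> carrier E" if "(b, e) \<in> G" for b e
    using Psub[OF PG] that by blast
  have Gfg: "(f a, g a) \<in> G" if "a \<in> carrier A" for a
    using Pfg[OF PG] that by blast
  note Guniq = Puniq[OF PG] and Gadd = Padd[OF PG] and Gsmult = Psmult[OF PG]
  have Gzero: "(\<zero>\<^bsub>B\<^esub>, \<zero>\<^bsub>E\<^esub>) \<in> G"
    using Gsmult[OF A.R.zero_closed Gfg[OF A.M.zero_closed]]
      mod_homD(1)[OF fh A.M.zero_closed] mod_homD(1)[OF g A.M.zero_closed] by simp
  have Gneg: "(\<ominus>\<^bsub>B\<^esub> b, \<ominus>\<^bsub>E\<^esub> e) \<in> G" if "(b, e) \<in> G" for b e
    using Gsmult[of "\<ominus>\<^bsub>R\<^esub> \<one>\<^bsub>R\<^esub>", OF _ that] Gsub[OF that]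
    by (simp add: B.smult_l_minus E.smult_l_minus)
  have total: "b \<in> Domain G" if b: "b \<in> carrier B" for b
  proof -
    define I where "I = {r \<in> carrier R. r \<odot>\<^bsub>B\<^esub> b \<in> Domain G}"
    define h where "h r = (THE e. (r \<odot>\<^bsub>B\<^esub> b, e) \<in> G)" for r
    have hI: "h r = e" if "(r \<odot>\<^bsub>B\<^esub> b, e) \<in> G" for r e
      unfolding h_def using that by (rule the_equality) (rule Guniq[OF _ that])
    have hG: "(r \<odot>\<^bsub>B\<^esub> b, h r) \<in> G" if "r \<in> I" for r
      using that hI[of r] unfolding I_def by (elim CollectE conjE DomainE) simp
    have add: "((r \<oplus>\<^bsub>R\<^esub> s) \<odot>\<^bsub>B\<^esub> b, h r \<oplus>\<^bsub>E\<^esub> h s) \<in> G" if "r \<in> I" "s \<in> I" for r s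
      using Gadd[OF hG[OF that(1)] hG[OF that(2)]] that b by (simp add: I_def B.smult_l_distr)
    have mult: "((r \<otimes>\<^bsub>R\<^esub> s) \<odot>\<^bsub>B\<^esub> b, r \<odot>\<^bsub>E\<^esub> h s) \<in> G" if "r \<in> carrier R" "s \<in> I" for r s
      using Gsmult[OF that(1) hG[OF that(2)]] that b by (simp add: I_def B.smult_assoc1)
    have I: "ideal I R"
    proof (rule idealI)
      show "ring R" by (rule A.R.ring_axioms)
      show "subgroup I (add_monoid R)"
      proof (rule A.R.add.subgroupI)
        show "I \<subseteq> carrier R" by (auto simp: I_def)
        show "I \<noteq> {}" using Gzero b by (auto simp: I_def intro!: exI[of _ "\<zero>\<^bsub>R\<^esub>"])
        show "\<ominus>\<^bsub>R\<^esub> r \<in> I" if "r \<in> I" for r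
          using Gneg[OF hG[OF that]] that b by (auto simp: I_def B.smult_l_minus)
        show "r \<oplus>\<^bsub>R\<^esub> s \<in> I" if "r \<in> I" "s \<in> I" for r s
          using add[OF that] that by (auto simp: I_def)
      qed
      show "x \<otimes>\<^bsub>R\<^esub> a \<in> I" if "a \<in> I" "x \<in> carrier R" for a x
        using mult[OF that(2,1)] that by (auto simp: I_def)
      moreover have "a \<in> carrier R" if "a \<in> I" for a using that by (simp add: I_def)
      ultimately show "a \<otimes>\<^bsub>R\<^esub> x \<in> I" if "a \<in> I" "x \<in> carrier R" for a x
        using that by (metis A.R.m_comm)
    qed
    obtain e0 where e0: "e0 \<in> carrier E" "\<And>r. r \<in> I \<Longrightarrow> h r = r \<odot>\<^bsub>E\<^esub> e0"
      using injective_module_ideal[OF inj A.R.is_cring I, of h, OF _ hI[OF add] hI[OF mult]]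
        Gsub[OF hG] by blast
    define G' where "G' = {(x \<oplus>\<^bsub>B\<^esub> r \<odot>\<^bsub>B\<^esub> b, e \<oplus>\<^bsub>E\<^esub> r \<odot>\<^bsub>E\<^esub> e0) | x e r. (x, e) \<in> G \<and> r \<in> carrier R}"
    have G'I: "(x \<oplus>\<^bsub>B\<^esub> r \<odot>\<^bsub>B\<^esub> b, e \<oplus>\<^bsub>E\<^esub> r \<odot>\<^bsub>E\<^esub> e0) \<in> G'" if "(x, e) \<in> G" "r \<in> carrier R" for x e r
      using that by (auto simp: G'_def)
    have G'E: "\<exists>x e r. (x, e) \<in> G \<and> r \<in> carrier R \<and> y = x \<oplus>\<^bsub>B\<^esub> r \<odot>\<^bsub>B\<^esub> b \<and> u = e \<oplus>\<^bsub>E\<^esub> r \<odot>\<^bsub>E\<^esub> e0"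
      if "(y, u) \<in> G'" for y u
      using that by (auto simp: G'_def)
    have sub: "G \<subseteq> G'"
    proof
      fix p assume "p \<in> G"
      moreover obtain x e where "p = (x, e)" by force
      ultimately show "p \<in> G'"
        using G'I[of x e "\<zero>\<^bsub>R\<^esub>"] Gsub[of x e] b e0(1) by simp
    qed
    have "P G'" unfolding P_def
    proof (intro conjI allI impI)
      show "G' \<subseteq> carrier B \<times> carrier E"
        using Gsub b e0(1) by (auto simp: G'_def)
      show "(\<lambda>a. (f a, g a)) ` carrier A \<subseteq> G'" using sub Gfg by auto
    next
      fix y u u' assume "(y, u) \<in> G'" "(y, u') \<in> G'"
      from G'E[OF this(1)] G'E[OF this(2)] obtain x e r x' e' r' where
        1: "(x, e) \<in> G" "r \<in> carrier R" "y = x \<oplus>\<^bsub>B\<^esub> r \<odot>\<^bsub>B\<^esub> b" "u = e \<oplus>\<^bsub>E\<^esub> r \<odot>\<^bsub>E\<^esub> e0" and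
        2: "(x', e') \<in> G" "r' \<in> carrier R" "y = x' \<oplus>\<^bsub>B\<^esub> r' \<odot>\<^bsub>B\<^esub> b" "u' = e' \<oplus>\<^bsub>E\<^esub> r' \<odot>\<^bsub>E\<^esub> e0"
        by blast
      define s where "s = r \<oplus>\<^bsub>R\<^esub> \<ominus>\<^bsub>R\<^esub> r'"
      have s: "s \<in> carrier R" "r = r' \<oplus>\<^bsub>R\<^esub> s"
        using 1(2) 2(2) by (simp_all add: s_def A.R.a_lcomm[of r' r] A.R.r_neg)
      note c = Gsub[OF 1(1)] Gsub[OF 2(1)] b e0(1) 1(2) 2(2) s(1)
      have "x' \<oplus>\<^bsub>B\<^esub> r' \<odot>\<^bsub>B\<^esub> b = (x \<oplus>\<^bsub>B\<^esub> s \<odot>\<^bsub>B\<^esub> b) \<oplus>\<^bsub>B\<^esub> r' \<odot>\<^bsub>B\<^esub> b"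
        using 1(3) 2(3) c by (simp add: s(2) B.smult_l_distr B.M.a_ac)
      then have x': "x' = x \<oplus>\<^bsub>B\<^esub> s \<odot>\<^bsub>B\<^esub> b"
        using c by (simp add: B.M.add.r_cancel)
      then have "\<ominus>\<^bsub>B\<^esub> x \<oplus>\<^bsub>B\<^esub> x' = s \<odot>\<^bsub>B\<^esub> b" using c by (simp add: B.M.r_neg1)
      then have sG: "(s \<odot>\<^bsub>B\<^esub> b, \<ominus>\<^bsub>E\<^esub> e \<oplus>\<^bsub>E\<^esub> e') \<in> G" using Gadd[OF Gneg[OF 1(1)] 2(1)] by simp
      then have "s \<in> I" using c by (auto simp: I_def)
      then have "\<ominus>\<^bsub>E\<^esub> e \<oplus>\<^bsub>E\<^esub> e' = s \<odot>\<^bsub>E\<^esub> e0" using hI[OF sG] e0(2) by simp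
      then have "e \<oplus>\<^bsub>E\<^esub> s \<odot>\<^bsub>E\<^esub> e0 = e'" using c by (metis E.M.r_neg2 E.M.a_inv_closed)
      then show "u = u'" using c unfolding 1(4) 2(4)
        by (auto simp: s(2) E.smult_l_distr E.M.a_ac)
    next
      fix y u y' u' assume "(y, u) \<in> G'" "(y', u') \<in> G'"
      from G'E[OF this(1)] G'E[OF this(2)] obtain x e r x' e' r' where
        1: "(x, e) \<in> G" "r \<in> carrier R" "y = x \<oplus>\<^bsub>B\<^esub> r \<odot>\<^bsub>B\<^esub> b" "u = e \<oplus>\<^bsub>E\<^esub> r \<odot>\<^bsub>E\<^esub> e0" and
        2: "(x', e') \<in> G" "r' \<in> carrier R" "y' = x' \<oplus>\<^bsub>B\<^esub> r' \<odot>\<^bsub>B\<^esub> b" "u' = e' \<oplus>\<^bsub>E\<^esub> r' \<odot>\<^bsub>E\<^esub> e0"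
        by blast
      show "(y \<oplus>\<^bsub>B\<^esub> y', u \<oplus>\<^bsub>E\<^esub> u') \<in> G'"
        using G'I[OF Gadd[OF 1(1) 2(1)], of "r \<oplus>\<^bsub>R\<^esub> r'"] Gsub[OF 1(1)] Gsub[OF 2(1)] 1(2) 2(2) b e0(1)
        by (simp add: 1(3,4) 2(3,4) B.smult_l_distr E.smult_l_distr B.M.a_ac E.M.a_ac)
    next
      fix t y u assume t: "t \<in> carrier R" "(y, u) \<in> G'"
      from G'E[OF this(2)] obtain x e r where
        1: "(x, e) \<in> G" "r \<in> carrier R" "y = x \<oplus>\<^bsub>B\<^esub> r \<odot>\<^bsub>B\<^esub> b" "u = e \<oplus>\<^bsub>E\<^esub> r \<odot>\<^bsub>E\<^esub> e0"
        by blast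
      show "(t \<odot>\<^bsub>B\<^esub> y, t \<odot>\<^bsub>E\<^esub> u) \<in> G'"
        using G'I[OF Gsmult[OF t(1) 1(1)], of "t \<otimes>\<^bsub>R\<^esub> r"] Gsub[OF 1(1)] 1(2) t(1) b e0(1)
        by (simp add: 1(3,4) B.smult_r_distr E.smult_r_distr B.smult_assoc1 E.smult_assoc1)
    qed
    then have "G' = G" using max sub by blast
    then show ?thesis
      using G'I[OF Gzero A.R.one_closed] b e0(1) by auto
  qed
  define h where "h = (\<lambda>b\<in>carrier B. THE e. (b, e) \<in> G)"
  have hI: "h b = e" if "(b, e) \<in> G" for b e
    using Gsub[OF that] the_equality[of "\<lambda>e. (b, e) \<in> G", OF that Guniq[OF _ that]]
    by (simp add: h_def)
  have hG: "(b, h b) \<in> G" if "b \<in> carrier B" for b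
    using total[OF that] hI[of b] by (elim DomainE) simp
  have "h \<in> mod_hom R B E"
  proof (rule mod_homI)
    show "h b \<in> carrier E" if "b \<in> carrier B" for b
      using Gsub[OF hG[OF that]] by simp
    show "h (b \<oplus>\<^bsub>B\<^esub> b') = h b \<oplus>\<^bsub>E\<^esub> h b'" if "b \<in> carrier B" "b' \<in> carrier B" for b b'
      by (rule hI[OF Gadd[OF hG[OF that(1)] hG[OF that(2)]]])
    show "h (r \<odot>\<^bsub>B\<^esub> b) = r \<odot>\<^bsub>E\<^esub> h b" if "r \<in> carrier R" "b \<in> carrier B" for r b
      by (rule hI[OF Gsmult[OF that(1) hG[OF that(2)]]])
  qed (simp add: h_def)
  then show ?thesis using hI Gfg by blast
qed

end

theory Submission
  imports Defs "HOL-Algebra.Free_Abelian_Groups"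
begin

text \<open>The proof compares ranks. Write \<open>M\<^sup>\<circ>\<close> for the Matlis dual and \<open>\<phi>\<close> for the canonical map into the
  bidual. An epimorphism from \<open>M\<close> onto \<open>M\<^sup>\<circ>\<^sup>\<circ>\<close> dualizes to a monomorphism from the bidual of \<open>M\<^sup>\<circ>\<close> into
  \<open>M\<^sup>\<circ>\<close> (\<open>dual_mono_of_epi\<close>), and \<open>M\<close> is reflexive as soon as \<open>M\<^sup>\<circ>\<close> is, because a functional that
  separates a point of the bidual from the image of \<open>\<phi>\<close> would itself be an evaluation, at the zero
  element (\<open>reflexive_if_dual_reflexive\<close>). So only embeddings of \<open>M\<^sup>\<circ>\<^sup>\<circ>\<close> into \<open>M\<close> matter.

  Such an embedding restricts to every submodule \<open>M\<^sub>I = {x. I x = 0}\<close>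
  (\<open>bidual_embedding_annihilated\<close>). If \<open>M\<close> is not reflexive, noetherianity gives an ideal \<open>I\<close> that is
  maximal with \<open>M\<^sub>I\<close> not reflexive. The lemma \<open>divide_evaluation\<close> says that if \<open>a f\<close> lies in the image
  of \<open>\<phi>\<close> and the elements killed by \<open>a\<close> form a reflexive module, then \<open>f\<close> lies in the image as
  well. It shows first that \<open>I\<close> is prime, and then that it suffices to find, for every \<open>f\<close> in the
  bidual of \<open>M\<^sub>I\<close>, some \<open>r\<close> outside \<open>I\<close> with \<open>r f\<close> in the image of \<open>\<phi>\<close>. In other words, the cokernel
  of \<open>\<phi>\<close> has to be torsion over the domain \<open>R / I\<close> (\<open>cokernel_torsion\<close>).

  Here the rank over \<open>R / I\<close> enters. If a maximal independent subset \<open>B\<close> of \<open>M\<^sub>I\<close> is finite, the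
  composition of \<open>\<phi>\<close> with the embedding maps \<open>B\<close> to an independent set of the same size, so every
  element of the bidual depends on \<open>\<phi>(B)\<close>. If \<open>B\<close> is infinite, the bidual contains an independent
  family indexed by all subsets of \<open>B\<close> (\<open>bidual_family_independent\<close>), which is too large to embed
  into a module of rank \<open>|B|\<close>. Over a field this is the fact that
  the double dual of an infinite-dimensional space has larger dimension.\<close>

section \<open>Independent sets in a pregeometry\<close>

locale pregeometry =
  fixes U :: "'a set" and cl :: "'a set \<Rightarrow> 'a set"
  assumes cl_closed: "cl X \<subseteq> U"
    and cl_extensive: "X \<subseteq> U \<Longrightarrow> X \<subseteq> cl X"
    and cl_least: "X \<subseteq> cl Y \<Longrightarrow> Y \<subseteq> U \<Longrightarrow> cl X \<subseteq> cl Y"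
    and cl_finitary: "X \<subseteq> U \<Longrightarrow> x \<in> cl X \<Longrightarrow> \<exists>F \<in> Fpow X. x \<in> cl F"
    and cl_exchange: "insert x (insert y X) \<subseteq> U \<Longrightarrow> y \<in> cl (insert x X) \<Longrightarrow> y \<notin> cl X \<Longrightarrow> x \<in> cl (insert y X)"
begin

definition independent :: "'a set \<Rightarrow> bool"
  where "independent X \<longleftrightarrow> X \<subseteq> U \<and> (\<forall>x\<in>X. x \<notin> cl (X - {x}))"

lemma cl_mono: "X \<subseteq> Y \<Longrightarrow> Y \<subseteq> U \<Longrightarrow> cl X \<subseteq> cl Y"
  using cl_least[of X Y] cl_extensive[of Y] by blast

lemma independent_mono:
  assumes "independent X" "Y \<subseteq> X" shows "independent Y"
proof -
  have "cl (Y - {y}) \<subseteq> cl (X - {y})" for y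
    using assms by (intro cl_mono) (auto simp: independent_def)
  then show ?thesis using assms unfolding independent_def by blast
qed

lemma independent_insert:
  assumes X: "independent X" and x: "x \<in> U" "x \<notin> cl X"
  shows "independent (insert x X)"
  unfolding independent_def
proof (intro conjI ballI notI)
  have XU: "X \<subseteq> U" using X by (simp add: independent_def)
  then show "insert x X \<subseteq> U" using x(1) by simp
  have xX: "x \<notin> X" using cl_extensive[OF XU] x(2) by blast
  fix y assume y: "y \<in> insert x X" "y \<in> cl (insert x X - {y})"
  show False
  proof (cases "y = x")
    case True
    then show False using y(2) xX x(2) by simp
  next
    case False
    then have "y \<in> X" "insert x X - {y} = insert x (X - {y})" "insert y (X - {y}) = X"
      using y(1) by auto
    moreover have "y \<notin> cl (X - {y})" using X \<open>y \<in> X\<close> by (simp add: independent_def)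
    ultimately have "x \<in> cl X"
      using cl_exchange[of x y "X - {y}"] y(2) XU x(1) by auto
    then show False using x(2) by contradiction
  qed
qed

lemma basis_exists: "\<exists>B. independent B \<and> cl B = U"
proof -
  let ?I = "Collect independent"
  have "\<Union>C \<in> ?I" if ne: "C \<noteq> {}" and ch: "subset.chain ?I C" for C
  proof -
    have CI: "independent X" if "X \<in> C" for X
      using ch that by (auto simp: subset_chain_def)
    then have CU: "\<Union>C \<subseteq> U" by (auto simp: independent_def)
    have "x \<notin> cl (\<Union>C - {x})" if x: "x \<in> \<Union>C" for x
    proof
      assume "x \<in> cl (\<Union>C - {x})"
      then obtain F where F: "finite F" "F \<subseteq> \<Union>C - {x}" "x \<in> cl F"
        using cl_finitary[of "\<Union>C - {x}" x] CU by (auto simp: Fpow_def)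
      then obtain X where X: "X \<in> C" "insert x F \<subseteq> X"
        using finite_subset_Union_chain[OF _ _ ne ch, of "insert x F"] x by blast
      have "cl F \<subseteq> cl (X - {x})"
        using F(2) X CI[OF X(1)] by (intro cl_mono) (auto simp: independent_def)
      then show False using F(3) X CI[OF X(1)] by (auto simp: independent_def)
    qed
    then show ?thesis using CU by (auto simp: independent_def)
  qed
  moreover have "?I \<noteq> {}" by (auto simp: independent_def intro!: exI[of _ "{}"])
  ultimately obtain B where B: "independent B" "\<And>X. independent X \<Longrightarrow> B \<subseteq> X \<Longrightarrow> X = B"
    using subset_Zorn_nonempty[of ?I] by auto
  have "x \<in> cl B" if "x \<in> U" for x
  proof (rule ccontr)
    assume "x \<notin> cl B"
    then have "insert x B = B" using B(2)[OF independent_insert[OF B(1) that]] by blast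
    then have "x \<in> B" by blast
    moreover have "B \<subseteq> U" using B(1) by (simp add: independent_def)
    ultimately show False using \<open>x \<notin> cl B\<close> cl_extensive by blast
  qed
  then show ?thesis using B(1) cl_closed by blast
qed

text \<open>Steinitz exchange: an element of \<open>F\<close> outside \<open>C\<close> is either superfluous for spanning \<open>C\<close> or can be traded for an
  element of \<open>C\<close>. Both moves shrink \<open>F - C\<close>, which therefore drives the induction.\<close>

lemma independent_card_le:
  assumes "finite F" "F \<subseteq> U" "independent C" "C \<subseteq> cl F"
  shows "finite C \<and> card C \<le> card F"
  using assms
proof (induction "card (F - C)" arbitrary: F rule: less_induct)
  case (less F)
  have CU: "C \<subseteq> U" using less.prems(3) by (simp add: independent_def)
  show ?case
  proof (cases "F \<subseteq> C")
    case True
    have "c \<in> F" if c: "c \<in> C" for c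
    proof (rule ccontr)
      assume "c \<notin> F"
      then have "cl F \<subseteq> cl (C - {c})" using True CU by (intro cl_mono) auto
      then show False using c less.prems(3,4) by (auto simp: independent_def)
    qed
    then have "C = F" using True by blast
    then show ?thesis using less.prems(1) by simp
  next
    case False
    then obtain x where x: "x \<in> F" "x \<notin> C" by blast
    let ?F = "F - {x}"
    have smaller: "card (?F - C) < card (F - C)"
      using x less.prems(1) by (intro psubset_card_mono) auto
    show ?thesis
    proof (cases "C \<subseteq> cl ?F")
      case True
      then have "finite C \<and> card C \<le> card ?F"
        using less.hyps[OF smaller] less.prems by auto
      then show ?thesis using card_mono[OF less.prems(1), of ?F] by auto
    next
      case False
      then obtain c where c: "c \<in> C" "c \<notin> cl ?F" by blast
      let ?F' = "insert c ?F"
      have ins: "insert x ?F = F" using x by blast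
      have F'U: "?F' \<subseteq> U" using less.prems(2) c(1) CU by auto
      have "c \<notin> ?F" using cl_extensive[of ?F] c(2) F'U by blast
      have "x \<in> cl ?F'"
        using cl_exchange[of x c ?F] c less.prems(2,4) CU x ins by auto
      then have "F \<subseteq> cl ?F'" using cl_extensive[OF F'U] by blast
      then have "C \<subseteq> cl ?F'" using cl_least[OF _ F'U] less.prems(4) by blast
      moreover have "card (?F' - C) < card (F - C)"
        using smaller c(1) by (simp add: insert_Diff_if)
      ultimately have "finite C \<and> card C \<le> card ?F'"
        using less.hyps[of ?F'] less.prems F'U by auto
      moreover have "card ?F' = card F"
        using \<open>c \<notin> ?F\<close> less.prems(1) card_Suc_Diff1[OF less.prems(1) x(1)] by simp
      ultimately show ?thesis by simp
    qed
  qed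
qed

text \<open>Every element of \<open>C\<close> depends on a finite subset of \<open>B\<close>; an infinite \<open>B\<close> has only \<open>|B|\<close> finite
  subsets, and on each of them only finitely many elements of \<open>C\<close> depend.\<close>

lemma independent_lepoll_infinite:
  assumes "infinite B" "B \<subseteq> U" "independent C" "C \<subseteq> cl B"
  shows "C \<lesssim> B"
proof -
  have "\<exists>F\<in>Fpow B. c \<in> cl F" if "c \<in> C" for c
    using cl_finitary[OF assms(2)] that assms(4) by blast
  then have C: "C = (\<Union>F\<in>Fpow B. C \<inter> cl F)" by blast
  have "finite (C \<inter> cl F)" if F: "F \<in> Fpow B" for F
    using F assms(2) independent_card_le[of F "C \<inter> cl F"] independent_mono[OF assms(3), of "C \<inter> cl F"]
    by (auto simp: Fpow_def)
  then have "\<forall>F\<in>Fpow B. |C \<inter> cl F| \<le>o |B|"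
    using finite_lepoll_infinite[OF assms(1)] by (auto simp: lepoll_def card_of_ordLeq[symmetric])
  moreover have "|Fpow B| \<le>o |B|"
    using eqpoll_Fpow[OF assms(1)] by (auto simp: eqpoll_iff_card_of_ordIso intro: ordIso_imp_ordLeq)
  ultimately have "|\<Union>F\<in>Fpow B. C \<inter> cl F| \<le>o |B|"
    by (intro card_of_UNION_ordLeq_infinite assms(1))
  then show ?thesis using C by (auto simp: lepoll_def card_of_ordLeq[symmetric])
qed

lemma independent_spans_if_card_eq:
  assumes "finite B" "independent B" "cl B = U" "independent C" "finite C" "card C = card B"
  shows "cl C = U"
proof (rule ccontr)
  assume "cl C \<noteq> U"
  then obtain x where x: "x \<in> U" "x \<notin> cl C" using cl_closed by blast
  have *: "insert x C \<subseteq> cl B" "B \<subseteq> U"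
    using assms(2-4) x by (auto simp: independent_def)
  have "card (insert x C) \<le> card B"
    using independent_card_le[OF assms(1) *(2) independent_insert[OF assms(4) x] *(1)] by simp
  moreover have "x \<notin> C" using cl_extensive[of C] assms(4) x(2) by (auto simp: independent_def)
  ultimately show False using assms(5,6) by simp
qed

end


text \<open>A family of \<open>2\<^bsup>|B|\<^esup>\<close> subsets of \<open>B\<close> in which each member has, against any finitely many others, a point
  of its own. This makes the indicator functions linearly independent over any ring. The points
  encode pairs \<open>(F, H)\<close> of finite subsets of \<open>B\<close>, of which there are only \<open>|B|\<close>, and \<open>S\<close> selects those
  with \<open>S \<inter> F = H\<close>: a finite \<open>F\<close> suffices to tell \<open>S\<close> from finitely many other sets.\<close>

lemma separating_family:
  assumes "infinite B"
  shows "\<exists>X. \<forall>S\<in>Pow B. \<forall>T. finite T \<longrightarrow> T \<subseteq> Pow B - {S} \<longrightarrow> (\<exists>b\<in>B. b \<in> X S \<and> (\<forall>S'\<in>T. b \<notin> X S'))"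
proof -
  have F: "Fpow B \<lesssim> B" using eqpoll_Fpow[OF assms] eqpoll_imp_lepoll by blast
  have "B \<times> B \<lesssim> B"
    by (rule eqpoll_imp_lepoll) (simp only: eqpoll_iff_card_of_ordIso card_of_Times_same_infinite[OF assms])
  then have "Fpow B \<times> Fpow B \<lesssim> B"
    using times_lepoll_mono[OF F F] lepoll_trans by blast
  then obtain g where g: "inj_on g (Fpow B \<times> Fpow B)" "g ` (Fpow B \<times> Fpow B) \<subseteq> B"
    by (auto simp: lepoll_def)
  define X where "X S = {g (F, H) | F H. F \<in> Fpow B \<and> H \<in> Fpow B \<and> S \<inter> F = H}" for S
  show ?thesis
  proof (intro exI[of _ X] ballI allI impI)
    fix S T assume S: "S \<in> Pow B" and T: "finite T" "T \<subseteq> Pow B - {S}"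
    have "\<exists>x. x \<in> B \<and> (x \<in> S \<longleftrightarrow> x \<notin> S')" if "S' \<in> T" for S'
      using that S T(2) by blast
    then obtain d where d: "\<And>S'. S' \<in> T \<Longrightarrow> d S' \<in> B \<and> (d S' \<in> S \<longleftrightarrow> d S' \<notin> S')"
      by metis
    let ?F = "d ` T"
    have F: "?F \<in> Fpow B" "S \<inter> ?F \<in> Fpow B" using T(1) d by (auto simp: Fpow_def)
    have "g (?F, S \<inter> ?F) \<notin> X S'" if S': "S' \<in> T" for S'
    proof
      assume "g (?F, S \<inter> ?F) \<in> X S'"
      then obtain G H where GH: "g (?F, S \<inter> ?F) = g (G, H)" "G \<in> Fpow B" "H \<in> Fpow B" "S' \<inter> G = H"
        by (auto simp: X_def)
      then have "(?F, S \<inter> ?F) = (G, H)" using g(1) F by (auto dest!: inj_onD)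
      then have "S' \<inter> ?F = S \<inter> ?F" using GH(4) by auto
      then show False using d[OF S'] S' by blast
    qed
    moreover have "g (?F, S \<inter> ?F) \<in> X S" using F by (auto simp: X_def)
    moreover have "g (?F, S \<inter> ?F) \<in> B" using g(2) F by auto
    ultimately show "\<exists>b\<in>B. b \<in> X S \<and> (\<forall>S'\<in>T. b \<notin> X S')" by blast
  qed
qed

section \<open>Homomorphisms and submodules\<close>

lemma carrier_Hom_module [simp]: "carrier (Hom_module R A B) = mod_hom R A B"
  by (simp add: Hom_module_def)

lemma Hom_module_apply [simp]:
  assumes "x \<in> carrier A"
  shows "(f \<oplus>\<^bsub>Hom_module R A B\<^esub> g) x = f x \<oplus>\<^bsub>B\<^esub> g x"
    and "(r \<odot>\<^bsub>Hom_module R A B\<^esub> f) x = r \<odot>\<^bsub>B\<^esub> f x"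
    and "\<zero>\<^bsub>Hom_module R A B\<^esub> x = \<zero>\<^bsub>B\<^esub>"
  using assms by (simp_all add: Hom_module_def)

lemma mod_hom_eqI:
  assumes "f \<in> mod_hom R A B" "g \<in> mod_hom R A B" "\<And>x. x \<in> carrier A \<Longrightarrow> f x = g x"
  shows "f = g"
  using mod_homD(4)[OF assms(1)] mod_homD(4)[OF assms(2)] assms(3) by (rule extensionalityI)

lemma mod_hom_zero:
  assumes "module R A" "module R B" "f \<in> mod_hom R A B"
  shows "f \<zero>\<^bsub>A\<^esub> = \<zero>\<^bsub>B\<^esub>"
proof -
  interpret A: module R A by fact
  interpret B: module R B by fact
  show ?thesis
    using mod_homD(3)[OF assms(3) A.R.zero_closed A.M.zero_closed]
      mod_homD(1)[OF assms(3) A.M.zero_closed] by simp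
qed

lemma mod_hom_minus:
  assumes "module R A" "module R B" "f \<in> mod_hom R A B" "x \<in> carrier A"
  shows "f (\<ominus>\<^bsub>A\<^esub> x) = \<ominus>\<^bsub>B\<^esub> f x"
proof -
  interpret A: module R A by fact
  interpret B: module R B by fact
  show ?thesis
    using mod_homD(3)[OF assms(3), of "\<ominus>\<^bsub>R\<^esub> \<one>\<^bsub>R\<^esub>" x] assms(4) mod_homD(1)[OF assms(3,4)]
    by (simp add: A.smult_l_minus B.smult_l_minus)
qed

lemma Hom_module_minus_apply:
  assumes "module R A" "module R B" "f \<in> mod_hom R A B" "x \<in> carrier A"
  shows "(\<ominus>\<^bsub>Hom_module R A B\<^esub> f) x = \<ominus>\<^bsub>B\<^esub> f x"
proof -
  interpret A: module R A by fact
  interpret B: module R B by fact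
  interpret H: module R "Hom_module R A B" by (rule Hom_module_is_module) fact+
  have "\<ominus>\<^bsub>Hom_module R A B\<^esub> f = (\<ominus>\<^bsub>R\<^esub> \<one>\<^bsub>R\<^esub>) \<odot>\<^bsub>Hom_module R A B\<^esub> f"
    using H.smult_l_minus[of "\<one>\<^bsub>R\<^esub>" f] assms(3) by simp
  then show ?thesis
    using assms(4) mod_homD(1)[OF assms(3,4)] by (simp add: B.smult_l_minus)
qed

lemma restrict_comp_hom:
  assumes "f \<in> mod_hom R A B" "g \<in> mod_hom R B C" "module R A"
  shows "(\<lambda>x\<in>carrier A. g (f x)) \<in> mod_hom R A C"
proof -
  interpret A: module R A by fact
  show ?thesis
    using assms(1,2) by (intro mod_homI) (auto simp: mod_homD)
qed

lemma inclusion_mono: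
  assumes "module R A" "carrier A \<subseteq> carrier M" "add A = add M" "smult A = smult M"
  shows "(\<lambda>x\<in>carrier A. x) \<in> mod_mono R A M"
proof -
  interpret A: module R A by fact
  have "(\<lambda>x\<in>carrier A. x) \<in> mod_hom R A M"
    using assms(2-4) A.M.add.m_closed A.smult_closed by (intro mod_homI) auto
  then show ?thesis by (simp add: mod_mono_def inj_on_def)
qed

lemma (in module) submoduleI':
  assumes "H \<subseteq> carrier M" "H \<noteq> {}"
    and "\<And>a b. a \<in> H \<Longrightarrow> b \<in> H \<Longrightarrow> a \<oplus>\<^bsub>M\<^esub> b \<in> H"
    and smult: "\<And>a x. a \<in> carrier R \<Longrightarrow> x \<in> H \<Longrightarrow> a \<odot>\<^bsub>M\<^esub> x \<in> H"
  shows "submodule H R M"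
proof (rule submoduleI)
  show "\<zero>\<^bsub>M\<^esub> \<in> H" using assms(1,2) smult[OF R.zero_closed] by fastforce
  show "\<ominus>\<^bsub>M\<^esub> a \<in> H" if "a \<in> H" for a
    using smult[of "\<ominus> \<one>" a] that assms(1) by (auto simp: smult_l_minus)
qed fact+

lemma image_submodule:
  assumes "module R A" "module R B" "f \<in> mod_hom R A B" "submodule L R A"
  shows "submodule (f ` L) R B"
proof -
  interpret A: module R A by fact
  interpret B: module R B by fact
  note LD = A.submoduleE[OF assms(4)]
  show ?thesis
  proof (rule B.submoduleI')
    show "f ` L \<subseteq> carrier B" using mod_homD(1)[OF assms(3)] LD(1) by blast
    show "f ` L \<noteq> {}" using LD(2) by simp
    show "x \<oplus>\<^bsub>B\<^esub> y \<in> f ` L" if xy: "x \<in> f ` L" "y \<in> f ` L" for x y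
    proof -
      obtain a b where ab: "a \<in> L" "b \<in> L" "x = f a" "y = f b" using xy by blast
      then have "x \<oplus>\<^bsub>B\<^esub> y = f (a \<oplus>\<^bsub>A\<^esub> b)" using mod_homD(2)[OF assms(3), of a b] LD(1)[THEN subsetD] by simp
      then show ?thesis using LD(5)[OF ab(1,2)] by (rule image_eqI)
    qed
    show "r \<odot>\<^bsub>B\<^esub> x \<in> f ` L" if rx: "r \<in> carrier R" "x \<in> f ` L" for r x
    proof -
      obtain a where a: "a \<in> L" "x = f a" using rx by blast
      then have "r \<odot>\<^bsub>B\<^esub> x = f (r \<odot>\<^bsub>A\<^esub> a)" using mod_homD(3)[OF assms(3) rx(1), of a] LD(1)[THEN subsetD] by simp
      then show ?thesis using LD(4)[OF rx(1) a(1)] by (rule image_eqI)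
    qed
  qed
qed

lemma (in module) ideal_transporter:
  assumes L: "submodule L R M" and x: "x \<in> carrier M"
  shows "ideal {r \<in> carrier R. r \<odot>\<^bsub>M\<^esub> x \<in> L} R"
proof -
  note LD = submoduleE[OF L]
  have mult: "a \<otimes> r \<in> {r \<in> carrier R. r \<odot>\<^bsub>M\<^esub> x \<in> L}"
    if "r \<in> {r \<in> carrier R. r \<odot>\<^bsub>M\<^esub> x \<in> L}" "a \<in> carrier R" for a r
    using that LD(4)[of a "r \<odot>\<^bsub>M\<^esub> x"] x by (simp add: smult_assoc1)
  show ?thesis
  proof (rule idealI)
    show "ring R" by (rule R.ring_axioms)
    show "subgroup {r \<in> carrier R. r \<odot>\<^bsub>M\<^esub> x \<in> L} (add_monoid R)"
    proof (rule R.add.subgroupI)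
      have "\<zero>\<^bsub>M\<^esub> \<in> L" using LD(2) LD(4)[OF R.zero_closed] LD(1) by fastforce
      then show "{r \<in> carrier R. r \<odot>\<^bsub>M\<^esub> x \<in> L} \<noteq> {}"
        using x by (auto intro!: exI[of _ \<zero>])
      show "\<ominus> r \<in> {r \<in> carrier R. r \<odot>\<^bsub>M\<^esub> x \<in> L}" if "r \<in> {r \<in> carrier R. r \<odot>\<^bsub>M\<^esub> x \<in> L}" for r
        using that x LD(3) by (simp add: smult_l_minus)
      show "r \<oplus> s \<in> {r \<in> carrier R. r \<odot>\<^bsub>M\<^esub> x \<in> L}"
        if "r \<in> {r \<in> carrier R. r \<odot>\<^bsub>M\<^esub> x \<in> L}" "s \<in> {r \<in> carrier R. r \<odot>\<^bsub>M\<^esub> x \<in> L}" for r s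
        using that x LD(5) by (simp add: smult_l_distr)
    qed auto
    show "a \<otimes> r \<in> {r \<in> carrier R. r \<odot>\<^bsub>M\<^esub> x \<in> L}"
      if "r \<in> {r \<in> carrier R. r \<odot>\<^bsub>M\<^esub> x \<in> L}" "a \<in> carrier R" for a r
      using that by (rule mult)
    show "r \<otimes> a \<in> {r \<in> carrier R. r \<odot>\<^bsub>M\<^esub> x \<in> L}"
      if "r \<in> {r \<in> carrier R. r \<odot>\<^bsub>M\<^esub> x \<in> L}" "a \<in> carrier R" for a r
    proof -
      have "r \<otimes> a = a \<otimes> r" using that by (simp add: R.m_comm)
      then show ?thesis using mult[OF that] by simp
    qed
  qed
qed

lemma (in module) submodule_zero: "submodule {\<zero>\<^bsub>M\<^esub>} R M"
  by (rule submoduleI') simp_all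

definition annihilated :: "('r, 'c) ring_scheme \<Rightarrow> 'r set \<Rightarrow> ('r, 'm, 'f) module_scheme \<Rightarrow> ('r, 'm, 'f) module_scheme"
  where "annihilated R I M = M\<lparr>carrier := {x \<in> carrier M. \<forall>r\<in>I. r \<odot>\<^bsub>M\<^esub> x = \<zero>\<^bsub>M\<^esub>}\<rparr>"

lemma annihilated_simps [simp]:
  "add (annihilated R I M) = add M" "\<zero>\<^bsub>annihilated R I M\<^esub> = \<zero>\<^bsub>M\<^esub>"
  "smult (annihilated R I M) = smult M"
  by (simp_all add: annihilated_def)

lemma in_carrier_annihilated:
  "x \<in> carrier (annihilated R I M) \<longleftrightarrow> x \<in> carrier M \<and> (\<forall>r\<in>I. r \<odot>\<^bsub>M\<^esub> x = \<zero>\<^bsub>M\<^esub>)"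
  by (simp add: annihilated_def)

lemma submodule_annihilated:
  assumes "module R M" "I \<subseteq> carrier R"
  shows "submodule (carrier (annihilated R I M)) R M"
proof -
  interpret M: module R M by fact
  show ?thesis
  proof (rule M.submoduleI')
    have "\<zero>\<^bsub>M\<^esub> \<in> carrier (annihilated R I M)"
      using assms(2) by (auto simp: in_carrier_annihilated)
    then show "carrier (annihilated R I M) \<noteq> {}" by blast
    show "a \<odot>\<^bsub>M\<^esub> x \<in> carrier (annihilated R I M)"
      if "a \<in> carrier R" "x \<in> carrier (annihilated R I M)" for a x
    proof -
      have "r \<odot>\<^bsub>M\<^esub> (a \<odot>\<^bsub>M\<^esub> x) = \<zero>\<^bsub>M\<^esub>" if "r \<in> I" for r
      proof -
        have "r \<odot>\<^bsub>M\<^esub> (a \<odot>\<^bsub>M\<^esub> x) = a \<odot>\<^bsub>M\<^esub> (r \<odot>\<^bsub>M\<^esub> x)"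
          using that \<open>a \<in> carrier R\<close> \<open>x \<in> _\<close> assms(2) M.R.m_comm[of r a]
            M.smult_assoc1[of r a x] M.smult_assoc1[of a r x]
          by (auto simp: in_carrier_annihilated)
        then show ?thesis using that \<open>a \<in> carrier R\<close> \<open>x \<in> _\<close> by (simp add: in_carrier_annihilated)
      qed
      then show ?thesis using that by (auto simp: in_carrier_annihilated)
    qed
    show "carrier (annihilated R I M) \<subseteq> carrier M" by (simp add: annihilated_def)
    show "x \<oplus>\<^bsub>M\<^esub> y \<in> carrier (annihilated R I M)"
      if xy: "x \<in> carrier (annihilated R I M)" "y \<in> carrier (annihilated R I M)" for x y
    proof -
      have "r \<odot>\<^bsub>M\<^esub> (x \<oplus>\<^bsub>M\<^esub> y) = \<zero>\<^bsub>M\<^esub>" if "r \<in> I" for r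
        using xy that assms(2) M.smult_r_distr[of r x y] by (auto simp: in_carrier_annihilated)
      then show ?thesis using xy by (simp add: in_carrier_annihilated)
    qed
  qed
qed

lemma annihilated_module:
  assumes "module R M" "I \<subseteq> carrier R"
  shows "module R (annihilated R I M)"
  using submodule.submodule_is_module[OF submodule_annihilated[OF assms] assms(1)]
  by (simp add: annihilated_def)

lemma restrict_annihilated_hom:
  assumes "module R M" "I \<subseteq> carrier R" "n \<in> mod_hom R M E"
  shows "restrict n (carrier (annihilated R I M)) \<in> mod_hom R (annihilated R I M) E"
proof -
  interpret A: module R "annihilated R I M" by (rule annihilated_module) fact+
  show ?thesis
    using A.M.add.m_closed A.smult_closed
    by (intro mod_homI) (auto simp: mod_homD[OF assms(3)] in_carrier_annihilated)
qed


section \<open>Extending homomorphisms into the injective hull\<close>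

locale matlis_duality = noetherian_local_ring R \<mm> for R :: "('r, 'c) ring_scheme" (structure) and \<mm> +
  fixes E :: "('r, 'e, 'd) module_scheme"
  assumes hull: "injective_hull R (residue_module R \<mm>) E"
begin

lemma injective_E: "injective_module R E" and module_E: "module R E"
  using hull by (auto simp: injective_hull_def injective_module_def)

sublocale E: module R E by (rule module_E)

lemma proper_ideal_subset:
  assumes "ideal J R" "J \<noteq> carrier R" shows "J \<subseteq> \<mm>"
proof -
  let ?A = "{I. ideal I R \<and> I \<noteq> carrier R \<and> J \<subseteq> I}"
  have "\<Union>C \<in> ?A" if ne: "C \<noteq> {}" and ch: "subset.chain ?A C" for C
  proof -
    have "C \<subseteq> ?A" using ch by (simp add: subset_chain_def)
    moreover have "\<Union>C \<in> C"
      using ideal_chain_is_trivial[OF ne] ch by (auto simp: subset_chain_def)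
    ultimately show ?thesis by blast
  qed
  then obtain I where I: "I \<in> ?A" "\<And>I'. I' \<in> ?A \<Longrightarrow> I \<subseteq> I' \<Longrightarrow> I' = I"
    using subset_Zorn_nonempty[of ?A] assms by auto
  have "maximalideal I R"
  proof (rule maximalidealI)
    show "ideal I R" "carrier R \<noteq> I" using I(1) by auto
    show "K = I \<or> K = carrier R" if "ideal K R" "I \<subseteq> K" "K \<subseteq> carrier R" for K
      using I that by blast
  qed
  then show ?thesis using maximal_unique I(1) by blast
qed

text \<open>The image of \<open>1\<close> under the embedding of the residue field in \<open>E\<close>. It is what makes \<open>E\<close> a cogenerator,
  since every proper ideal lies in the maximal ideal, which kills it.\<close>

lemma socle_element:
  obtains e where "e \<in> carrier E" "e \<noteq> \<zero>\<^bsub>E\<^esub>"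
    "\<And>J r. ideal J R \<Longrightarrow> J \<noteq> carrier R \<Longrightarrow> r \<in> J \<Longrightarrow> r \<odot>\<^bsub>E\<^esub> e = \<zero>\<^bsub>E\<^esub>"
proof -
  interpret m: maximalideal \<mm> R by (rule maximal)
  let ?k = "residue_module R \<mm>"
  interpret k: module R ?k by (rule residue_module_is_module[OF is_cring m.is_ideal])
  interpret Q: cring "R Quot \<mm>" by (rule m.quotient_is_cring[OF is_cring])
  obtain i where i: "i \<in> mod_hom R ?k E" "inj_on i (carrier ?k)"
    using hull by (auto simp: injective_hull_def mod_mono_def)
  have q: "r \<odot>\<^bsub>?k\<^esub> \<one>\<^bsub>R Quot \<mm>\<^esub> = \<mm> +> r" if "r \<in> carrier R" for r
    using that ring_hom_closed[OF m.rcos_ring_hom] by (simp add: residue_module_def)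
  have one: "\<one>\<^bsub>R Quot \<mm>\<^esub> \<in> carrier ?k" by (simp add: residue_module_def)
  have zero: "\<zero>\<^bsub>?k\<^esub> = \<mm>" by (simp add: residue_module_def FactRing_def)
  have in_m: "\<mm> +> r = \<mm>" if "r \<in> \<mm>" for r
    using a_coset_join2[OF m.a_Hcarr[OF that] m.a_subgroup that] .
  let ?e = "i \<one>\<^bsub>R Quot \<mm>\<^esub>"
  show thesis
  proof
    show "?e \<in> carrier E" by (rule mod_homD(1)[OF i(1) one])
    show "?e \<noteq> \<zero>\<^bsub>E\<^esub>"
    proof
      assume "?e = \<zero>\<^bsub>E\<^esub>"
      then have "\<one>\<^bsub>R Quot \<mm>\<^esub> = \<zero>\<^bsub>?k\<^esub>"
        using inj_onD[OF i(2) _ one k.M.zero_closed] mod_hom_zero[OF k.module_axioms module_E i(1)] by simp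
      then have "\<mm> +> \<one> = \<mm>" by (simp add: zero FactRing_def)
      then have "\<one> \<in> \<mm>" using a_coset_join1[OF _ one_closed m.a_subgroup] by simp
      then show False using m.one_imp_carrier m.I_notcarr by simp
    qed
    show "r \<odot>\<^bsub>E\<^esub> ?e = \<zero>\<^bsub>E\<^esub>" if "ideal J R" "J \<noteq> carrier R" "r \<in> J" for J r
    proof -
      have r: "r \<in> \<mm>" using proper_ideal_subset that by blast
      then have rR: "r \<in> carrier R" by (rule m.a_Hcarr)
      have "r \<odot>\<^bsub>E\<^esub> ?e = i (r \<odot>\<^bsub>?k\<^esub> \<one>\<^bsub>R Quot \<mm>\<^esub>)" using mod_homD(3)[OF i(1) rR one] by simp
      also have "\<dots> = i \<zero>\<^bsub>?k\<^esub>" using q[OF rR] in_m[OF r] zero by simp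
      finally show ?thesis using mod_hom_zero[OF k.module_axioms module_E i(1)] by simp
    qed
  qed
qed

text \<open>Injectivity in the form used below: a partial homomorphism is given by its graph \<open>G\<close>, so that a
  partial map need not be defined by choosing representatives; by linearity, single-valuedness
  only has to be checked at zero.\<close>

lemma extend_relation:
  assumes "module R M" and G: "G \<subseteq> carrier M \<times> carrier E" "G \<noteq> {}"
    and add: "\<And>x e y e'. (x, e) \<in> G \<Longrightarrow> (y, e') \<in> G \<Longrightarrow> (x \<oplus>\<^bsub>M\<^esub> y, e \<oplus>\<^bsub>E\<^esub> e') \<in> G"
    and smult: "\<And>r x e. r \<in> carrier R \<Longrightarrow> (x, e) \<in> G \<Longrightarrow> (r \<odot>\<^bsub>M\<^esub> x, r \<odot>\<^bsub>E\<^esub> e) \<in> G"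
    and zero: "\<And>e. (\<zero>\<^bsub>M\<^esub>, e) \<in> G \<Longrightarrow> e = \<zero>\<^bsub>E\<^esub>"
  shows "\<exists>n \<in> mod_hom R M E. \<forall>x e. (x, e) \<in> G \<longrightarrow> n x = e"
proof -
  interpret M: module R M by fact
  have GD: "x \<in> carrier M" "e \<in> carrier E" if "(x, e) \<in> G" for x e using G(1) that by auto
  have uniq: "e = e'" if "(x, e) \<in> G" "(x, e') \<in> G" for x e e'
  proof -
    have "(x \<oplus>\<^bsub>M\<^esub> (\<ominus>\<one>) \<odot>\<^bsub>M\<^esub> x, e \<oplus>\<^bsub>E\<^esub> (\<ominus>\<one>) \<odot>\<^bsub>E\<^esub> e') \<in> G"
      by (intro add smult that) simp
    then have "e \<oplus>\<^bsub>E\<^esub> \<ominus>\<^bsub>E\<^esub> e' = \<zero>\<^bsub>E\<^esub>"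
      using zero GD that by (simp add: M.smult_l_minus E.smult_l_minus M.M.r_neg)
    then show ?thesis using GD that by (simp add: E.M.add.inv_solve_right')
  qed
  define g where "g x = (THE e. (x, e) \<in> G)" for x
  have gI: "g x = e" if "(x, e) \<in> G" for x e
    unfolding g_def using that by (rule the_equality) (rule uniq[OF _ that])
  let ?L = "Domain G"
  have L: "submodule ?L R M"
  proof (rule M.submoduleI')
    show "?L \<subseteq> carrier M" "?L \<noteq> {}" using G by auto
    show "x \<oplus>\<^bsub>M\<^esub> y \<in> ?L" if "x \<in> ?L" "y \<in> ?L" for x y
      using that add by (elim DomainE) blast
    show "r \<odot>\<^bsub>M\<^esub> x \<in> ?L" if "r \<in> carrier R" "x \<in> ?L" for r x
      using that smult by (elim DomainE) blast
  qed
  let ?A = "M\<lparr>carrier := ?L\<rparr>"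
  have A: "module R ?A" by (rule submodule.submodule_is_module[OF L \<open>module R M\<close>])
  have inc: "(\<lambda>x\<in>?L. x) \<in> mod_mono R ?A M"
    using inclusion_mono[OF A, of M] GD by auto
  have g: "restrict g ?L \<in> mod_hom R ?A E"
  proof (rule mod_homI)
    show "restrict g ?L x \<in> carrier E" if "x \<in> carrier ?A" for x
      using that gI GD by (auto elim!: DomainE)
    show "restrict g ?L (x \<oplus>\<^bsub>?A\<^esub> y) = restrict g ?L x \<oplus>\<^bsub>E\<^esub> restrict g ?L y"
      if xy: "x \<in> carrier ?A" "y \<in> carrier ?A" for x y
    proof -
      obtain e e' where "(x, e) \<in> G" "(y, e') \<in> G" using xy by auto
      then show ?thesis using add[of x e y e'] gI by auto
    qed
    show "restrict g ?L (r \<odot>\<^bsub>?A\<^esub> x) = r \<odot>\<^bsub>E\<^esub> restrict g ?L x"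
      if rx: "r \<in> carrier R" "x \<in> carrier ?A" for r x
    proof -
      obtain e where "(x, e) \<in> G" using rx by auto
      then show ?thesis using smult[OF rx(1), of x e] gI by auto
    qed
  qed simp
  obtain n where n: "n \<in> mod_hom R M E" "\<And>x. x \<in> ?L \<Longrightarrow> n ((\<lambda>x\<in>?L. x) x) = restrict g ?L x"
    using injective_module_extend[OF injective_E A \<open>module R M\<close> inc g] by auto
  then have "n x = e" if "(x, e) \<in> G" for x e
    using gI[OF that] n(2)[of x] that by auto
  then show ?thesis using n(1) by blast
qed

lemma extend_by_element:
  assumes "module R M" "submodule L R M" "b \<in> carrier M" "e \<in> carrier E"
    and kill: "\<And>r. r \<in> carrier R \<Longrightarrow> r \<odot>\<^bsub>M\<^esub> b \<in> L \<Longrightarrow> r \<odot>\<^bsub>E\<^esub> e = \<zero>\<^bsub>E\<^esub>"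
  shows "\<exists>n \<in> mod_hom R M E. n b = e \<and> (\<forall>x\<in>L. n x = \<zero>\<^bsub>E\<^esub>)"
proof -
  interpret M: module R M by fact
  note LD = M.submoduleE[OF assms(2)]
  have L0: "\<zero>\<^bsub>M\<^esub> \<in> L" using LD(2) LD(4)[OF zero_closed] LD(1) by fastforce
  define G where "G = {(r \<odot>\<^bsub>M\<^esub> b \<oplus>\<^bsub>M\<^esub> x, r \<odot>\<^bsub>E\<^esub> e) | r x. r \<in> carrier R \<and> x \<in> L}"
  have GI: "(r \<odot>\<^bsub>M\<^esub> b \<oplus>\<^bsub>M\<^esub> x, r \<odot>\<^bsub>E\<^esub> e) \<in> G" if "r \<in> carrier R" "x \<in> L" for r x
    using that by (auto simp: G_def)
  have LM: "x \<in> carrier M" if "x \<in> L" for x using LD(1) that by blast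
  have "\<exists>n \<in> mod_hom R M E. \<forall>x e. (x, e) \<in> G \<longrightarrow> n x = e"
  proof (rule extend_relation[OF assms(1)])
    show "G \<subseteq> carrier M \<times> carrier E" using assms(3,4) LM by (auto simp: G_def)
    show "G \<noteq> {}" using GI[OF zero_closed L0] by blast
    show "(y \<oplus>\<^bsub>M\<^esub> z, u \<oplus>\<^bsub>E\<^esub> v) \<in> G" if yz: "(y, u) \<in> G" "(z, v) \<in> G" for y u z v
    proof -
      obtain r x s x' where 1: "y = r \<odot>\<^bsub>M\<^esub> b \<oplus>\<^bsub>M\<^esub> x" "u = r \<odot>\<^bsub>E\<^esub> e" "r \<in> carrier R" "x \<in> L"
        "z = s \<odot>\<^bsub>M\<^esub> b \<oplus>\<^bsub>M\<^esub> x'" "v = s \<odot>\<^bsub>E\<^esub> e" "s \<in> carrier R" "x' \<in> L"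
        using yz by (auto simp: G_def)
      then have "y \<oplus>\<^bsub>M\<^esub> z = (r \<oplus> s) \<odot>\<^bsub>M\<^esub> b \<oplus>\<^bsub>M\<^esub> (x \<oplus>\<^bsub>M\<^esub> x')" "u \<oplus>\<^bsub>E\<^esub> v = (r \<oplus> s) \<odot>\<^bsub>E\<^esub> e"
        using assms(3,4) LM by (simp_all add: M.smult_l_distr E.smult_l_distr M.M.a_ac)
      then show ?thesis using GI[of "r \<oplus> s" "x \<oplus>\<^bsub>M\<^esub> x'"] 1 LD(5) by simp
    qed
    show "(t \<odot>\<^bsub>M\<^esub> y, t \<odot>\<^bsub>E\<^esub> u) \<in> G" if t: "t \<in> carrier R" "(y, u) \<in> G" for t y u
    proof -
      obtain r x where 1: "y = r \<odot>\<^bsub>M\<^esub> b \<oplus>\<^bsub>M\<^esub> x" "u = r \<odot>\<^bsub>E\<^esub> e" "r \<in> carrier R" "x \<in> L"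
        using t by (auto simp: G_def)
      then have "t \<odot>\<^bsub>M\<^esub> y = (t \<otimes> r) \<odot>\<^bsub>M\<^esub> b \<oplus>\<^bsub>M\<^esub> t \<odot>\<^bsub>M\<^esub> x" "t \<odot>\<^bsub>E\<^esub> u = (t \<otimes> r) \<odot>\<^bsub>E\<^esub> e"
        using assms(3,4) LM t(1) by (simp_all add: M.smult_assoc1 E.smult_assoc1 M.smult_r_distr)
      then show ?thesis using GI[of "t \<otimes> r" "t \<odot>\<^bsub>M\<^esub> x"] 1 t(1) LD(4) by simp
    qed
    show "u = \<zero>\<^bsub>E\<^esub>" if "(\<zero>\<^bsub>M\<^esub>, u) \<in> G" for u
    proof -
      obtain r x where 1: "\<zero>\<^bsub>M\<^esub> = r \<odot>\<^bsub>M\<^esub> b \<oplus>\<^bsub>M\<^esub> x" "u = r \<odot>\<^bsub>E\<^esub> e" "r \<in> carrier R" "x \<in> L"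
        using \<open>(\<zero>\<^bsub>M\<^esub>, u) \<in> G\<close> by (auto simp: G_def)
      then have "r \<odot>\<^bsub>M\<^esub> b = \<ominus>\<^bsub>M\<^esub> x" using assms(3) LM M.M.minus_equality M.smult_closed by metis
      then show ?thesis using kill[of r] 1 LD(3) by simp
    qed
  qed
  then obtain n where n: "n \<in> mod_hom R M E" "\<And>x e. (x, e) \<in> G \<Longrightarrow> n x = e" by blast
  have "n b = e" using n(2)[OF GI[OF one_closed L0]] assms(3,4) by simp
  moreover have "n x = \<zero>\<^bsub>E\<^esub>" if "x \<in> L" for x
    using n(2)[OF GI[OF zero_closed that]] assms(3,4) LM[OF that] by simp
  ultimately show ?thesis using n(1) by (intro bexI[of _ n] conjI ballI)
qed

lemma separation:
  assumes "module R M" "submodule L R M" "x \<in> carrier M" "x \<notin> L"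
  shows "\<exists>n \<in> mod_hom R M E. n x \<noteq> \<zero>\<^bsub>E\<^esub> \<and> (\<forall>y\<in>L. n y = \<zero>\<^bsub>E\<^esub>)"
proof -
  interpret M: module R M by fact
  obtain e where e: "e \<in> carrier E" "e \<noteq> \<zero>\<^bsub>E\<^esub>"
    "\<And>J r. ideal J R \<Longrightarrow> J \<noteq> carrier R \<Longrightarrow> r \<in> J \<Longrightarrow> r \<odot>\<^bsub>E\<^esub> e = \<zero>\<^bsub>E\<^esub>"
    using socle_element by blast
  let ?J = "{r \<in> carrier R. r \<odot>\<^bsub>M\<^esub> x \<in> L}"
  have "\<one> \<notin> ?J" using assms(3,4) by simp
  then have "?J \<noteq> carrier R" by blast
  then have "r \<odot>\<^bsub>E\<^esub> e = \<zero>\<^bsub>E\<^esub>" if "r \<in> carrier R" "r \<odot>\<^bsub>M\<^esub> x \<in> L" for r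
    using e(3)[OF M.ideal_transporter[OF assms(2,3)]] that by blast
  then obtain n where "n \<in> mod_hom R M E" "n x = e" "\<forall>y\<in>L. n y = \<zero>\<^bsub>E\<^esub>"
    using extend_by_element[OF assms(1-3) e(1)] by auto
  then show ?thesis using e(2) by (intro bexI[of _ n]) simp_all
qed

lemma extend_annihilated:
  assumes "module R M" "I \<subseteq> carrier R" "g \<in> mod_hom R (annihilated R I M) E"
  shows "\<exists>n \<in> mod_hom R M E. restrict n (carrier (annihilated R I M)) = g"
proof -
  let ?A = "annihilated R I M"
  have A: "module R ?A" by (rule annihilated_module[OF assms(1,2)])
  have i: "(\<lambda>x\<in>carrier ?A. x) \<in> mod_mono R ?A M"
    by (rule inclusion_mono[OF A]) (auto simp: in_carrier_annihilated)
  obtain n where n: "n \<in> mod_hom R M E" "\<forall>x\<in>carrier ?A. n ((\<lambda>x\<in>carrier ?A. x) x) = g x"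
    using injective_module_extend[OF injective_E A assms(1) i assms(3)] by blast
  have "restrict n (carrier ?A) = g"
    using n(2) mod_homD(4)[OF assms(3)] by (intro extensionalityI[of _ "carrier ?A"]) auto
  then show ?thesis using n(1) by blast
qed

text \<open>A functional that vanishes on the kernel of multiplication by \<open>a\<close> factors through the image
  \<open>a M\<close>, and the factor extends from \<open>a M\<close> to \<open>M\<close>.\<close>

lemma divide_hom:
  assumes "module R M" "a \<in> carrier R" "n \<in> mod_hom R M E"
    and kill: "\<And>x. x \<in> carrier M \<Longrightarrow> a \<odot>\<^bsub>M\<^esub> x = \<zero>\<^bsub>M\<^esub> \<Longrightarrow> n x = \<zero>\<^bsub>E\<^esub>"
  shows "\<exists>n' \<in> mod_hom R M E. n = a \<odot>\<^bsub>Hom_module R M E\<^esub> n'"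
proof -
  interpret M: module R M by fact
  interpret D: module R "Hom_module R M E" by (rule Hom_module_is_module[OF assms(1) module_E])
  define G where "G = (\<lambda>x. (a \<odot>\<^bsub>M\<^esub> x, n x)) ` carrier M"
  note nD = mod_homD[OF assms(3)]
  have "\<exists>n' \<in> mod_hom R M E. \<forall>x e. (x, e) \<in> G \<longrightarrow> n' x = e"
  proof (rule extend_relation[OF assms(1)])
    show "G \<subseteq> carrier M \<times> carrier E" using assms(2) nD(1) by (auto simp: G_def)
    show "G \<noteq> {}" using M.M.zero_closed by (auto simp: G_def)
    show "(y \<oplus>\<^bsub>M\<^esub> z, u \<oplus>\<^bsub>E\<^esub> v) \<in> G" if "(y, u) \<in> G" "(z, v) \<in> G" for y u z v
    proof -
      obtain x x' where "x \<in> carrier M" "x' \<in> carrier M" "y = a \<odot>\<^bsub>M\<^esub> x" "u = n x" "z = a \<odot>\<^bsub>M\<^esub> x'" "v = n x'"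
        using \<open>(y, u) \<in> G\<close> \<open>(z, v) \<in> G\<close> by (auto simp: G_def)
      then show ?thesis unfolding G_def
        using assms(2) nD(2) by (intro image_eqI[of _ _ "x \<oplus>\<^bsub>M\<^esub> x'"]) (auto simp: M.smult_r_distr)
    qed
    show "(t \<odot>\<^bsub>M\<^esub> y, t \<odot>\<^bsub>E\<^esub> u) \<in> G" if t: "t \<in> carrier R" "(y, u) \<in> G" for t y u
    proof -
      obtain x where "x \<in> carrier M" "y = a \<odot>\<^bsub>M\<^esub> x" "u = n x" using t by (auto simp: G_def)
      then show ?thesis unfolding G_def
        using assms(2) nD(3) t(1)
        by (intro image_eqI[of _ _ "t \<odot>\<^bsub>M\<^esub> x"]) (auto simp: M.smult_assoc1[symmetric] m_comm)
    qed
    show "u = \<zero>\<^bsub>E\<^esub>" if "(\<zero>\<^bsub>M\<^esub>, u) \<in> G" for u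
      using that kill by (auto simp: G_def)
  qed
  then obtain n' where n': "n' \<in> mod_hom R M E" "\<And>x e. (x, e) \<in> G \<Longrightarrow> n' x = e" by blast
  have "n = a \<odot>\<^bsub>Hom_module R M E\<^esub> n'"
  proof (rule mod_hom_eqI[OF assms(3)])
    show "a \<odot>\<^bsub>Hom_module R M E\<^esub> n' \<in> mod_hom R M E" using D.smult_closed[OF assms(2)] n'(1) by simp
    fix x assume x: "x \<in> carrier M"
    then have "n' (a \<odot>\<^bsub>M\<^esub> x) = n x" by (intro n'(2)) (auto simp: G_def)
    then show "n x = (a \<odot>\<^bsub>Hom_module R M E\<^esub> n') x"
      using x mod_homD(3)[OF n'(1) assms(2) x] by simp
  qed
  then show ?thesis using n'(1) by (rule bexI)
qed

section \<open>Descent of reflexivity along multiplication\<close>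

lemma canonical_map_apply:
  "x \<in> carrier M \<Longrightarrow> n \<in> mod_hom R M E \<Longrightarrow> canonical_map R E M x n = n x"
  by (simp add: canonical_map_def)

lemma reflexiveI:
  assumes "module R M"
    and "\<And>f. f \<in> mod_hom R (Hom_module R M E) E \<Longrightarrow> \<exists>x\<in>carrier M. \<forall>n\<in>mod_hom R M E. f n = n x"
  shows "matlis_reflexive R E M"
  unfolding matlis_reflexive_def carrier_Hom_module
proof
  show "canonical_map R E M ` carrier M \<subseteq> mod_hom R (Hom_module R M E) E"
    using mod_homD(1)[OF canonical_map_hom[OF assms(1) module_E]] by auto
  show "mod_hom R (Hom_module R M E) E \<subseteq> canonical_map R E M ` carrier M"
  proof
    fix f assume f: "f \<in> mod_hom R (Hom_module R M E) E"
    then obtain x where x: "x \<in> carrier M" "\<forall>n\<in>mod_hom R M E. f n = n x" using assms(2) by blast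
    have "f = canonical_map R E M x"
    proof (rule mod_hom_eqI[OF f])
      show "canonical_map R E M x \<in> mod_hom R (Hom_module R M E) E"
        using mod_homD(1)[OF canonical_map_hom[OF assms(1) module_E] x(1)] by simp
    qed (use x in \<open>simp add: canonical_map_apply\<close>)
    then show "f \<in> canonical_map R E M ` carrier M" using x(1) by (rule image_eqI)
  qed
qed

lemma reflexiveD:
  assumes "matlis_reflexive R E M" "f \<in> mod_hom R (Hom_module R M E) E"
  obtains x where "x \<in> carrier M" "\<And>n. n \<in> mod_hom R M E \<Longrightarrow> f n = n x"
proof -
  have "f \<in> canonical_map R E M ` carrier M" using assms by (simp add: matlis_reflexive_def)
  then show thesis using that by (auto simp: canonical_map_apply)
qed

text \<open>An element \<open>g\<close> of the bidual that \<open>a\<close> kills vanishes on \<open>a M\<^sup>\<circ>\<close>, which by \<open>divide_hom\<close> consists of the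
  functionals that vanish on the submodule killed by \<open>a\<close>. Hence \<open>g\<close> only depends on the restriction of
  its argument to that submodule and lives in the bidual of the latter.\<close>

lemma killed_by_reflexive:
  assumes M: "module R M" and a: "a \<in> carrier R"
    and refl: "matlis_reflexive R E (annihilated R {a} M)"
    and g: "g \<in> mod_hom R (Hom_module R M E) E"
    and kill: "\<And>n. n \<in> mod_hom R M E \<Longrightarrow> a \<odot>\<^bsub>E\<^esub> g n = \<zero>\<^bsub>E\<^esub>"
  obtains x where "x \<in> carrier M" "\<And>n. n \<in> mod_hom R M E \<Longrightarrow> g n = n x"
proof -
  let ?A = "annihilated R {a} M"
  let ?D = "Hom_module R M E" and ?DA = "Hom_module R ?A E"
  have aR: "{a} \<subseteq> carrier R" using a by simp
  have A: "module R ?A" by (rule annihilated_module[OF M aR])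
  interpret M: module R M by (rule M)
  interpret D: module R ?D by (rule Hom_module_is_module[OF M module_E])
  interpret DA: module R ?DA by (rule Hom_module_is_module[OF A module_E])
  note gD = mod_homD(1-3)[OF g, unfolded carrier_Hom_module]
  have AM: "x \<in> carrier M" if "x \<in> carrier ?A" for x using that by (simp add: in_carrier_annihilated)
  have vanish: "g n = \<zero>\<^bsub>E\<^esub>" if n: "n \<in> mod_hom R M E" "\<And>x. x \<in> carrier ?A \<Longrightarrow> n x = \<zero>\<^bsub>E\<^esub>" for n
  proof -
    obtain n' where n': "n' \<in> mod_hom R M E" "n = a \<odot>\<^bsub>?D\<^esub> n'"
      using divide_hom[OF M a n(1)] n(2) by (auto simp: in_carrier_annihilated)
    then show ?thesis using gD(3)[OF a n'(1)] kill[OF n'(1)] by simp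
  qed
  have cong: "g n = g n'"
    if n: "n \<in> mod_hom R M E" "n' \<in> mod_hom R M E" "\<And>x. x \<in> carrier ?A \<Longrightarrow> n x = n' x" for n n'
  proof -
    let ?d = "n \<oplus>\<^bsub>?D\<^esub> \<ominus>\<^bsub>?D\<^esub> n'"
    have mn': "\<ominus>\<^bsub>?D\<^esub> n' \<in> mod_hom R M E" using n(2) D.M.a_inv_closed by simp
    have d: "?d \<in> mod_hom R M E" using n(1) mn' D.M.add.m_closed by simp
    have "?d x = \<zero>\<^bsub>E\<^esub>" if x: "x \<in> carrier ?A" for x
      using AM[OF x] n(3)[OF x] mod_homD(1)[OF n(2) AM[OF x]]
      by (simp add: Hom_module_minus_apply[OF M module_E n(2)] E.M.r_neg)
    then have "g ?d = \<zero>\<^bsub>E\<^esub>" by (rule vanish[OF d])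
    moreover have "g ?d = g n \<oplus>\<^bsub>E\<^esub> \<ominus>\<^bsub>E\<^esub> g n'"
      using gD(2)[OF n(1) mn'] mod_hom_minus[OF D.module_axioms module_E g] n(2) by simp
    ultimately show ?thesis using gD(1) n(1,2) by (simp add: E.M.add.inv_solve_right')
  qed
  have "\<exists>n. n \<in> mod_hom R M E \<and> restrict n (carrier ?A) = k" if "k \<in> mod_hom R ?A E" for k
    using extend_annihilated[OF M aR that] by blast
  then obtain ext where ext: "\<And>k. k \<in> mod_hom R ?A E \<Longrightarrow> ext k \<in> mod_hom R M E \<and> restrict (ext k) (carrier ?A) = k"
    by metis
  have extx: "ext k x = k x" if "k \<in> mod_hom R ?A E" "x \<in> carrier ?A" for k x
    using ext[OF that(1)] that(2) by (metis restrict_apply')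
  let ?f = "\<lambda>k\<in>mod_hom R ?A E. g (ext k)"
  have f: "?f \<in> mod_hom R ?DA E"
  proof (rule mod_homI; unfold carrier_Hom_module)
    show "?f k \<in> carrier E" if "k \<in> mod_hom R ?A E" for k
      using that ext gD(1) by simp
    show "?f (k \<oplus>\<^bsub>?DA\<^esub> l) = ?f k \<oplus>\<^bsub>E\<^esub> ?f l" if kl: "k \<in> mod_hom R ?A E" "l \<in> mod_hom R ?A E" for k l
    proof -
      have s: "k \<oplus>\<^bsub>?DA\<^esub> l \<in> mod_hom R ?A E" using kl DA.M.add.m_closed by simp
      have "g (ext (k \<oplus>\<^bsub>?DA\<^esub> l)) = g (ext k \<oplus>\<^bsub>?D\<^esub> ext l)"
        using kl s ext extx AM D.M.add.m_closed by (intro cong) auto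
      then show ?thesis using kl s ext gD(2) by simp
    qed
    show "?f (r \<odot>\<^bsub>?DA\<^esub> k) = r \<odot>\<^bsub>E\<^esub> ?f k" if rk: "r \<in> carrier R" "k \<in> mod_hom R ?A E" for r k
    proof -
      have s: "r \<odot>\<^bsub>?DA\<^esub> k \<in> mod_hom R ?A E" using rk DA.smult_closed by simp
      have "g (ext (r \<odot>\<^bsub>?DA\<^esub> k)) = g (r \<odot>\<^bsub>?D\<^esub> ext k)"
        using rk s ext extx AM D.smult_closed by (intro cong) auto
      then show ?thesis using rk s ext gD(3) by simp
    qed
  qed simp
  obtain x where x: "x \<in> carrier ?A" "\<And>k. k \<in> mod_hom R ?A E \<Longrightarrow> ?f k = k x"
    using reflexiveD[OF refl f] by blast
  have "g n = n x" if n: "n \<in> mod_hom R M E" for n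
  proof -
    let ?k = "restrict n (carrier ?A)"
    have k: "?k \<in> mod_hom R ?A E" by (rule restrict_annihilated_hom[OF M aR n])
    have "g n = g (ext ?k)" using n ext[OF k] extx[OF k] by (intro cong) auto
    then show ?thesis using x(2)[OF k] k x(1) by simp
  qed
  then show thesis using that AM[OF x(1)] by blast
qed

text \<open>If \<open>a f\<close> is the evaluation at \<open>x\<close>, then \<open>x\<close> is divisible by \<open>a\<close>: otherwise a functional would
  vanish on \<open>a M\<close> but not at \<open>x\<close>. After subtracting the evaluation at a quotient of \<open>x\<close> by \<open>a\<close>, the
  difference is killed by \<open>a\<close>.\<close>

lemma divide_evaluation:
  assumes M: "module R M" and a: "a \<in> carrier R"
    and refl: "matlis_reflexive R E (annihilated R {a} M)"
    and f: "f \<in> mod_hom R (Hom_module R M E) E"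
    and x: "x \<in> carrier M" and af: "\<And>n. n \<in> mod_hom R M E \<Longrightarrow> a \<odot>\<^bsub>E\<^esub> f n = n x"
  obtains y where "y \<in> carrier M" "\<And>n. n \<in> mod_hom R M E \<Longrightarrow> f n = n y"
proof -
  let ?D = "Hom_module R M E"
  interpret M: module R M by (rule M)
  interpret D: module R ?D by (rule Hom_module_is_module[OF M module_E])
  let ?DD = "Hom_module R ?D E"
  interpret DD: module R ?DD by (rule Hom_module_is_module[OF D.module_axioms module_E])
  note fD = mod_homD(1-3)[OF f, unfolded carrier_Hom_module]
  let ?m = "\<lambda>y\<in>carrier M. a \<odot>\<^bsub>M\<^esub> y"
  have m: "?m \<in> mod_hom R M M"
    using a by (intro mod_homI) (auto simp: M.smult_r_distr M.smult_assoc1[symmetric] m_comm)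
  have "x \<in> ?m ` carrier M"
  proof (rule ccontr)
    assume "x \<notin> ?m ` carrier M"
    then obtain n where n: "n \<in> mod_hom R M E" "n x \<noteq> \<zero>\<^bsub>E\<^esub>" "\<forall>y\<in>?m ` carrier M. n y = \<zero>\<^bsub>E\<^esub>"
      using separation[OF M image_submodule[OF M M m M.carrier_is_submodule] x] by blast
    have an: "a \<odot>\<^bsub>?D\<^esub> n \<in> mod_hom R M E" using D.smult_closed[OF a] n(1) by simp
    have "a \<odot>\<^bsub>?D\<^esub> n = \<zero>\<^bsub>?D\<^esub>"
    proof (rule mod_hom_eqI[OF an])
      show "\<zero>\<^bsub>?D\<^esub> \<in> mod_hom R M E" using D.M.zero_closed by simp
      show "(a \<odot>\<^bsub>?D\<^esub> n) y = \<zero>\<^bsub>?D\<^esub> y" if "y \<in> carrier M" for y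
        using that n(3) mod_homD(3)[OF n(1) a that] by auto
    qed
    then have "a \<odot>\<^bsub>E\<^esub> f n = \<zero>\<^bsub>E\<^esub>"
      using fD(3)[OF a n(1)] mod_hom_zero[OF D.module_axioms module_E f] by simp
    then show False using af[OF n(1)] n(2) by simp
  qed
  then obtain y where y: "y \<in> carrier M" "x = a \<odot>\<^bsub>M\<^esub> y" by auto
  let ?e = "canonical_map R E M y"
  have e: "?e \<in> mod_hom R ?D E"
    using mod_homD(1)[OF canonical_map_hom[OF M module_E] y(1)] by simp
  let ?g = "f \<oplus>\<^bsub>?DD\<^esub> \<ominus>\<^bsub>?DD\<^esub> ?e"
  have g: "?g \<in> mod_hom R ?D E" using e f DD.M.a_inv_closed DD.M.add.m_closed by simp
  have gn: "?g n = f n \<oplus>\<^bsub>E\<^esub> \<ominus>\<^bsub>E\<^esub> n y" if "n \<in> mod_hom R M E" for n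
    using that by (simp add: Hom_module_minus_apply[OF D.module_axioms module_E e] canonical_map_apply y(1))
  have "a \<odot>\<^bsub>E\<^esub> ?g n = \<zero>\<^bsub>E\<^esub>" if n: "n \<in> mod_hom R M E" for n
    using af[OF n] fD(1)[OF n] mod_homD(1)[OF n y(1)] mod_homD(3)[OF n a y(1)] a
    by (simp add: gn[OF n] y(2) E.smult_r_distr E.smult_r_minus E.M.r_neg)
  then obtain z where z: "z \<in> carrier M" "\<And>n. n \<in> mod_hom R M E \<Longrightarrow> ?g n = n z"
    using killed_by_reflexive[OF M a refl g] by blast
  have "f n = n (z \<oplus>\<^bsub>M\<^esub> y)" if n: "n \<in> mod_hom R M E" for n
  proof -
    have "n (z \<oplus>\<^bsub>M\<^esub> y) = f n \<oplus>\<^bsub>E\<^esub> \<ominus>\<^bsub>E\<^esub> n y \<oplus>\<^bsub>E\<^esub> n y"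
      using z(2)[OF n] gn[OF n] mod_homD(2)[OF n z(1) y(1)] by simp
    then show ?thesis
      using fD(1)[OF n] mod_homD(1)[OF n y(1)] by (simp add: E.M.a_assoc E.M.l_neg)
  qed
  then show thesis using that z(1) y(1) by (metis M.M.add.m_closed)
qed

section \<open>Embeddings of the bidual\<close>

lemma annihilated_insert:
  "annihilated R {a} (annihilated R I M) = annihilated R (insert a I) M"
proof -
  have "{x \<in> {x \<in> carrier M. \<forall>r\<in>I. r \<odot>\<^bsub>M\<^esub> x = \<zero>\<^bsub>M\<^esub>}. a \<odot>\<^bsub>M\<^esub> x = \<zero>\<^bsub>M\<^esub>} =
    {x \<in> carrier M. \<forall>r\<in>insert a I. r \<odot>\<^bsub>M\<^esub> x = \<zero>\<^bsub>M\<^esub>}" by blast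
  then show ?thesis by (simp add: annihilated_def)
qed

lemma annihilated_genideal:
  assumes "module R M" "I \<subseteq> carrier R"
  shows "annihilated R (Idl I) M = annihilated R I M"
proof -
  interpret M: module R M by fact
  have "r \<odot>\<^bsub>M\<^esub> x = \<zero>\<^bsub>M\<^esub>" if x: "x \<in> carrier M" "\<forall>r\<in>I. r \<odot>\<^bsub>M\<^esub> x = \<zero>\<^bsub>M\<^esub>" and r: "r \<in> Idl I" for x r
  proof -
    have "Idl I \<subseteq> {r \<in> carrier R. r \<odot>\<^bsub>M\<^esub> x \<in> {\<zero>\<^bsub>M\<^esub>}}"
      using M.ideal_transporter[OF M.submodule_zero x(1)] assms(2) x(2)
      by (intro genideal_minimal) auto
    then show ?thesis using r by auto
  qed
  then have "{x \<in> carrier M. \<forall>r\<in>Idl I. r \<odot>\<^bsub>M\<^esub> x = \<zero>\<^bsub>M\<^esub>} = {x \<in> carrier M. \<forall>r\<in>I. r \<odot>\<^bsub>M\<^esub> x = \<zero>\<^bsub>M\<^esub>}"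
    using genideal_self[OF assms(2)] by blast
  then show ?thesis by (simp add: annihilated_def)
qed

lemma bidual_killed:
  assumes "module R M" "f \<in> mod_hom R (Hom_module R M E) E" "n \<in> mod_hom R M E" "r \<in> carrier R"
    and "\<And>x. x \<in> carrier M \<Longrightarrow> r \<odot>\<^bsub>M\<^esub> x = \<zero>\<^bsub>M\<^esub>"
  shows "r \<odot>\<^bsub>E\<^esub> f n = \<zero>\<^bsub>E\<^esub>"
proof -
  let ?D = "Hom_module R M E"
  interpret D: module R ?D by (rule Hom_module_is_module[OF assms(1) module_E])
  have "r \<odot>\<^bsub>?D\<^esub> n = \<zero>\<^bsub>?D\<^esub>"
  proof (rule mod_hom_eqI)
    show "r \<odot>\<^bsub>?D\<^esub> n \<in> mod_hom R M E" "\<zero>\<^bsub>?D\<^esub> \<in> mod_hom R M E"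
      using D.smult_closed[OF assms(4)] assms(3) D.M.zero_closed by simp_all
    show "(r \<odot>\<^bsub>?D\<^esub> n) x = \<zero>\<^bsub>?D\<^esub> x" if "x \<in> carrier M" for x
      using that mod_homD(3)[OF assms(3,4) that] assms(5)[OF that] mod_hom_zero[OF assms(1) module_E assms(3)]
      by simp
  qed
  then show ?thesis
    using mod_homD(3)[OF assms(2,4), of n] assms(3) mod_hom_zero[OF D.module_axioms module_E assms(2)] by simp
qed

text \<open>Restriction of functionals to \<open>M\<^sub>I\<close> is onto because \<open>E\<close> is injective, so its dual embeds the bidual of
  \<open>M\<^sub>I\<close> in that of \<open>M\<close>. The bidual of \<open>M\<^sub>I\<close> is killed by \<open>I\<close>, so its image in \<open>M\<close> under \<open>u\<close> ends up in \<open>M\<^sub>I\<close>.\<close>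

lemma bidual_embedding_annihilated:
  assumes M: "module R M" and I: "I \<subseteq> carrier R"
    and u: "u \<in> mod_mono R (matlis_bidual R E M) M"
  shows "\<exists>v. v \<in> mod_mono R (matlis_bidual R E (annihilated R I M)) (annihilated R I M)"
proof -
  let ?A = "annihilated R I M"
  let ?D = "Hom_module R M E" and ?DA = "Hom_module R ?A E"
  let ?DD = "Hom_module R ?D E" and ?DDA = "Hom_module R ?DA E"
  have A: "module R ?A" by (rule annihilated_module[OF M I])
  interpret M: module R M by (rule M)
  interpret D: module R ?D by (rule Hom_module_is_module[OF M module_E])
  interpret DA: module R ?DA by (rule Hom_module_is_module[OF A module_E])
  interpret DD: module R ?DD by (rule Hom_module_is_module[OF D.module_axioms module_E])
  interpret DDA: module R ?DDA by (rule Hom_module_is_module[OF DA.module_axioms module_E])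
  have uh: "u \<in> mod_hom R ?DD M" and ui: "inj_on u (mod_hom R ?D E)"
    using u by (auto simp: mod_mono_def)
  let ?res = "\<lambda>n\<in>mod_hom R M E. restrict n (carrier ?A)"
  have AM: "x \<in> carrier M" if "x \<in> carrier ?A" for x using that by (simp add: in_carrier_annihilated)
  have res: "?res \<in> mod_hom R ?D ?DA"
  proof (rule mod_homI; unfold carrier_Hom_module)
    show "?res n \<in> mod_hom R ?A E" if "n \<in> mod_hom R M E" for n
      using restrict_annihilated_hom[OF M I that] that by simp
    show "?res (n \<oplus>\<^bsub>?D\<^esub> k) = ?res n \<oplus>\<^bsub>?DA\<^esub> ?res k" if "n \<in> mod_hom R M E" "k \<in> mod_hom R M E" for n k
      using that D.M.add.m_closed[of n k] AM by (auto simp: Hom_module_def)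
    show "?res (r \<odot>\<^bsub>?D\<^esub> n) = r \<odot>\<^bsub>?DA\<^esub> ?res n" if "r \<in> carrier R" "n \<in> mod_hom R M E" for r n
      using that D.smult_closed[of r n] AM by (auto simp: Hom_module_def)
  qed simp
  let ?w = "\<lambda>F. \<lambda>n\<in>mod_hom R M E. F (?res n)"
  have w: "?w F \<in> mod_hom R ?D E" if "F \<in> mod_hom R ?DA E" for F
    using restrict_comp_hom[OF res that D.module_axioms] by simp
  note resD = mod_homD(1)[OF res, unfolded carrier_Hom_module]
  have wadd: "?w (F \<oplus>\<^bsub>?DDA\<^esub> G) = ?w F \<oplus>\<^bsub>?DD\<^esub> ?w G" for F G
    using resD by (auto simp: Hom_module_def)
  have wsmult: "?w (r \<odot>\<^bsub>?DDA\<^esub> F) = r \<odot>\<^bsub>?DD\<^esub> ?w F" for r F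
    using resD by (auto simp: Hom_module_def)
  have winj: "F = G" if "F \<in> mod_hom R ?DA E" "G \<in> mod_hom R ?DA E" "?w F = ?w G" for F G
  proof (rule mod_hom_eqI[OF that(1,2)])
    fix k assume "k \<in> carrier ?DA"
    then obtain n where n: "n \<in> mod_hom R M E" "restrict n (carrier ?A) = k"
      using extend_annihilated[OF M I] by auto
    then show "F k = G k" using fun_cong[OF that(3), of n] by simp
  qed
  let ?v = "\<lambda>F\<in>mod_hom R ?DA E. u (?w F)"
  have wA: "u (?w F) \<in> carrier ?A" if F: "F \<in> mod_hom R ?DA E" for F
    unfolding in_carrier_annihilated
  proof (intro conjI ballI)
    show "u (?w F) \<in> carrier M" using mod_homD(1)[OF uh] w[OF F] by simp
    fix r assume r: "r \<in> I"
    then have rR: "r \<in> carrier R" using I by blast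
    have "r \<odot>\<^bsub>?DD\<^esub> ?w F = \<zero>\<^bsub>?DD\<^esub>"
    proof (rule mod_hom_eqI)
      show "r \<odot>\<^bsub>?DD\<^esub> ?w F \<in> mod_hom R ?D E" "\<zero>\<^bsub>?DD\<^esub> \<in> mod_hom R ?D E"
        using DD.smult_closed[OF rR] w[OF F] DD.M.zero_closed by simp_all
      show "(r \<odot>\<^bsub>?DD\<^esub> ?w F) n = \<zero>\<^bsub>?DD\<^esub> n" if n: "n \<in> carrier ?D" for n
        using bidual_killed[OF A F resD rR, of n] n r by (simp add: in_carrier_annihilated)
    qed
    then show "r \<odot>\<^bsub>M\<^esub> u (?w F) = \<zero>\<^bsub>M\<^esub>"
      using mod_homD(3)[OF uh rR, of "?w F"] w[OF F] mod_hom_zero[OF DD.module_axioms M uh] by simp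
  qed
  have "?v \<in> mod_hom R ?DDA ?A"
  proof (rule mod_homI; unfold carrier_Hom_module)
    show "?v F \<in> carrier ?A" if "F \<in> mod_hom R ?DA E" for F using wA[OF that] that by simp
    show "?v (F \<oplus>\<^bsub>?DDA\<^esub> G) = ?v F \<oplus>\<^bsub>?A\<^esub> ?v G"
      if FG: "F \<in> mod_hom R ?DA E" "G \<in> mod_hom R ?DA E" for F G
    proof -
      have "F \<oplus>\<^bsub>?DDA\<^esub> G \<in> mod_hom R ?DA E" using FG DDA.M.add.m_closed[of F G] by simp
      then have "?v (F \<oplus>\<^bsub>?DDA\<^esub> G) = u (?w F \<oplus>\<^bsub>?DD\<^esub> ?w G)" by (simp only: wadd restrict_apply')
      also have "\<dots> = u (?w F) \<oplus>\<^bsub>M\<^esub> u (?w G)" using mod_homD(2)[OF uh] w[OF FG(1)] w[OF FG(2)] by simp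
      finally show ?thesis using FG by simp
    qed
    show "?v (r \<odot>\<^bsub>?DDA\<^esub> F) = r \<odot>\<^bsub>?A\<^esub> ?v F" if rF: "r \<in> carrier R" "F \<in> mod_hom R ?DA E" for r F
    proof -
      have "r \<odot>\<^bsub>?DDA\<^esub> F \<in> mod_hom R ?DA E" using rF DDA.smult_closed[of r F] by simp
      then have "?v (r \<odot>\<^bsub>?DDA\<^esub> F) = u (r \<odot>\<^bsub>?DD\<^esub> ?w F)" by (simp only: wsmult restrict_apply')
      also have "\<dots> = r \<odot>\<^bsub>M\<^esub> u (?w F)" using mod_homD(3)[OF uh rF(1)] w[OF rF(2)] by simp
      finally show ?thesis using rF by simp
    qed
  qed simp
  moreover have "inj_on ?v (mod_hom R ?DA E)"
  proof (rule inj_onI)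
    fix F G assume FG: "F \<in> mod_hom R ?DA E" "G \<in> mod_hom R ?DA E" "?v F = ?v G"
    then have "u (?w F) = u (?w G)" by simp
    then have "?w F = ?w G" by (rule inj_onD[OF ui _ w[OF FG(1)] w[OF FG(2)]])
    then show "F = G" by (rule winj[OF FG(1,2)])
  qed
  ultimately have "?v \<in> mod_mono R ?DDA ?A" by (simp add: mod_mono_def)
  then show ?thesis by blast
qed

lemma dual_mono_of_epi:
  assumes M: "module R M" and p: "p \<in> mod_epi R M (matlis_bidual R E M)"
  shows "\<exists>u. u \<in> mod_mono R (matlis_bidual R E (matlis_dual R E M)) (matlis_dual R E M)"
proof -
  let ?D = "Hom_module R M E"
  let ?DD = "Hom_module R ?D E"
  let ?DDD = "Hom_module R ?DD E"
  interpret M: module R M by (rule M)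
  interpret D: module R ?D by (rule Hom_module_is_module[OF M module_E])
  interpret DD: module R ?DD by (rule Hom_module_is_module[OF D.module_axioms module_E])
  interpret DDD: module R ?DDD by (rule Hom_module_is_module[OF DD.module_axioms module_E])
  have ph: "p \<in> mod_hom R M ?DD" and ps: "p ` carrier M = mod_hom R ?D E"
    using p by (auto simp: mod_epi_def)
  note pD = mod_homD(1)[OF ph, unfolded carrier_Hom_module]
  let ?u = "\<lambda>g\<in>mod_hom R ?DD E. \<lambda>x\<in>carrier M. g (p x)"
  have "?u \<in> mod_hom R ?DDD ?D"
  proof (rule mod_homI; unfold carrier_Hom_module)
    show "?u g \<in> mod_hom R M E" if "g \<in> mod_hom R ?DD E" for g
      using restrict_comp_hom[OF ph that M] that by simp
    show "?u (g \<oplus>\<^bsub>?DDD\<^esub> h) = ?u g \<oplus>\<^bsub>?D\<^esub> ?u h" if "g \<in> mod_hom R ?DD E" "h \<in> mod_hom R ?DD E" for g h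
    proof -
      have "g \<oplus>\<^bsub>?DDD\<^esub> h \<in> mod_hom R ?DD E" using that DDD.M.add.m_closed[of g h] by simp
      then show ?thesis using that pD by (auto simp: Hom_module_def)
    qed
    show "?u (r \<odot>\<^bsub>?DDD\<^esub> g) = r \<odot>\<^bsub>?D\<^esub> ?u g" if "r \<in> carrier R" "g \<in> mod_hom R ?DD E" for r g
    proof -
      have "r \<odot>\<^bsub>?DDD\<^esub> g \<in> mod_hom R ?DD E" using that DDD.smult_closed[of r g] by simp
      then show ?thesis using that pD by (auto simp: Hom_module_def)
    qed
  qed simp
  moreover have "inj_on ?u (mod_hom R ?DD E)"
  proof (rule inj_onI)
    fix g h assume gh: "g \<in> mod_hom R ?DD E" "h \<in> mod_hom R ?DD E" "?u g = ?u h"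
    show "g = h"
    proof (rule mod_hom_eqI[OF gh(1,2)])
      fix F assume "F \<in> carrier ?DD"
      then obtain x where "x \<in> carrier M" "F = p x" using ps by auto
      then show "g F = h F" using gh(1,2) fun_cong[OF gh(3), of x] by simp
    qed
  qed
  ultimately have "?u \<in> mod_mono R ?DDD ?D" by (simp add: mod_mono_def)
  then show ?thesis by blast
qed

text \<open>A nonzero functional on the cokernel of the canonical map would be the evaluation at some \<open>n\<close> in
  \<open>M\<^sup>\<circ>\<close>; vanishing on the evaluations at points of \<open>M\<close> means that \<open>n = 0\<close>.\<close>

lemma reflexive_if_dual_reflexive:
  assumes M: "module R M" and refl: "matlis_reflexive R E (matlis_dual R E M)"
  shows "matlis_reflexive R E M"
proof (rule ccontr)
  let ?D = "Hom_module R M E"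
  let ?DD = "Hom_module R ?D E"
  interpret D: module R ?D by (rule Hom_module_is_module[OF M module_E])
  have DD: "module R ?DD" by (rule Hom_module_is_module[OF D.module_axioms module_E])
  have c: "canonical_map R E M \<in> mod_hom R M ?DD" by (rule canonical_map_hom[OF M module_E])
  assume "\<not> matlis_reflexive R E M"
  then obtain F where F: "F \<in> carrier ?DD" "F \<notin> canonical_map R E M ` carrier M"
    using mod_homD(1)[OF c] by (auto simp: matlis_reflexive_def)
  obtain g where g: "g \<in> mod_hom R ?DD E" "g F \<noteq> \<zero>\<^bsub>E\<^esub>"
    "\<And>G. G \<in> canonical_map R E M ` carrier M \<Longrightarrow> g G = \<zero>\<^bsub>E\<^esub>"
    using separation[OF DD image_submodule[OF M DD c module.carrier_is_submodule[OF M]] F] by blast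
  obtain n where n: "n \<in> carrier ?D" "\<And>G. G \<in> mod_hom R ?D E \<Longrightarrow> g G = G n"
    using reflexiveD[OF refl g(1)] by blast
  have "n = \<zero>\<^bsub>?D\<^esub>"
  proof (rule mod_hom_eqI)
    show "n \<in> mod_hom R M E" "\<zero>\<^bsub>?D\<^esub> \<in> mod_hom R M E" using n(1) D.M.zero_closed by simp_all
    show "n x = \<zero>\<^bsub>?D\<^esub> x" if x: "x \<in> carrier M" for x
      using g(3)[of "canonical_map R E M x"] n(2)[of "canonical_map R E M x"] x n(1) mod_homD(1)[OF c x]
      by (simp add: canonical_map_apply)
  qed
  then have "F n = \<zero>\<^bsub>E\<^esub>" using mod_hom_zero[OF D.module_axioms module_E] F(1) by simp
  then show False using g(2) n(2) F(1) by simp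
qed

end

section \<open>Rank of a module over a prime quotient\<close>

definition mod_span :: "('r, 'c) ring_scheme \<Rightarrow> ('r, 'm, 'f) module_scheme \<Rightarrow> 'm set \<Rightarrow> 'm set"
  where "mod_span R M X = \<Inter>{L. submodule L R M \<and> X \<subseteq> L}"

lemma span_minimal: "submodule L R M \<Longrightarrow> X \<subseteq> L \<Longrightarrow> mod_span R M X \<subseteq> L"
  by (auto simp: mod_span_def)

lemma span_superset: "X \<subseteq> mod_span R M X"
  by (auto simp: mod_span_def)

lemma span_mono: "X \<subseteq> Y \<Longrightarrow> mod_span R M X \<subseteq> mod_span R M Y"
  by (auto simp: mod_span_def)

lemma (in module) span_submodule:
  assumes "X \<subseteq> carrier M" shows "submodule (mod_span R M X) R M"
proof (rule submoduleI')
  have L0: "\<zero>\<^bsub>M\<^esub> \<in> L" if "submodule L R M" for L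
    using submoduleE(1,2)[OF that] submoduleE(4)[OF that R.zero_closed] by fastforce
  show "mod_span R M X \<subseteq> carrier M" by (rule span_minimal[OF carrier_is_submodule assms])
  have "\<zero>\<^bsub>M\<^esub> \<in> mod_span R M X" using L0 by (auto simp: mod_span_def)
  then show "mod_span R M X \<noteq> {}" by blast
  show "a \<oplus>\<^bsub>M\<^esub> b \<in> mod_span R M X" if "a \<in> mod_span R M X" "b \<in> mod_span R M X" for a b
    using that submoduleE(5) by (simp add: mod_span_def)
  show "a \<odot>\<^bsub>M\<^esub> x \<in> mod_span R M X" if "a \<in> carrier R" "x \<in> mod_span R M X" for a x
    using that submoduleE(4) by (simp add: mod_span_def)
qed

lemma span_image_subset:
  assumes "module R A" "module R B" "f \<in> mod_hom R A B" "X \<subseteq> carrier A"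
  shows "mod_span R B (f ` X) \<subseteq> f ` mod_span R A X"
  by (rule span_minimal[OF image_submodule[OF assms(1-3) module.span_submodule[OF assms(1,4)]]])
    (use span_superset[of X R A] in blast)

locale prime_annihilated_module = module R M + primeideal P R
  for R (structure) and M :: "('a, 'm, 'f) module_scheme" and P +
  assumes annihilated: "r \<in> P \<Longrightarrow> x \<in> carrier M \<Longrightarrow> r \<odot>\<^bsub>M\<^esub> x = \<zero>\<^bsub>M\<^esub>"
begin

text \<open>The elements that depend on \<open>X\<close> over the fraction field of \<open>R / P\<close>, that is, the preimage in \<open>M\<close>
  of the subspace generated by \<open>X\<close> in the localization at \<open>P\<close>.\<close>

definition rank_closure :: "'m set \<Rightarrow> 'm set"
  where "rank_closure X = {x \<in> carrier M. \<exists>r \<in> carrier R - P. r \<odot>\<^bsub>M\<^esub> x \<in> mod_span R M X}"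

lemma one_notin_P: "\<one> \<notin> P"
  using one_imp_carrier I_notcarr by blast

lemma mult_notin_P: "r \<in> carrier R - P \<Longrightarrow> s \<in> carrier R - P \<Longrightarrow> r \<otimes> s \<in> carrier R - P"
  using I_prime by auto

lemma rank_closure_superset:
  assumes "X \<subseteq> carrier M" shows "mod_span R M X \<subseteq> rank_closure X"
proof
  fix x assume x: "x \<in> mod_span R M X"
  have "x \<in> carrier M" using x submoduleE(1)[OF span_submodule[OF assms]] by blast
  then show "x \<in> rank_closure X"
    using x one_notin_P by (auto simp: rank_closure_def intro!: bexI[of _ \<one>])
qed

lemma rank_closure_submodule:
  assumes X: "X \<subseteq> carrier M" shows "submodule (rank_closure X) R M"
proof (rule submoduleI')
  note S = submoduleE[OF span_submodule[OF X]]
  show "rank_closure X \<subseteq> carrier M" by (auto simp: rank_closure_def)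
  show "rank_closure X \<noteq> {}" using rank_closure_superset[OF X] S(2) by blast
  show "x \<oplus>\<^bsub>M\<^esub> y \<in> rank_closure X" if xy: "x \<in> rank_closure X" "y \<in> rank_closure X" for x y
  proof -
    obtain r s where r: "r \<in> carrier R - P" "r \<odot>\<^bsub>M\<^esub> x \<in> mod_span R M X"
      and s: "s \<in> carrier R - P" "s \<odot>\<^bsub>M\<^esub> y \<in> mod_span R M X"
      and c: "x \<in> carrier M" "y \<in> carrier M"
      using xy by (auto simp: rank_closure_def)
    have "(r \<otimes> s) \<odot>\<^bsub>M\<^esub> (x \<oplus>\<^bsub>M\<^esub> y) = s \<odot>\<^bsub>M\<^esub> (r \<odot>\<^bsub>M\<^esub> x) \<oplus>\<^bsub>M\<^esub> r \<odot>\<^bsub>M\<^esub> (s \<odot>\<^bsub>M\<^esub> y)"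
      using r(1) s(1) c R.m_comm[of r s] smult_assoc1[of s r x] smult_assoc1[of r s y]
      by (simp add: smult_r_distr)
    also have "\<dots> \<in> mod_span R M X" using S(5)[OF S(4)[OF _ r(2)] S(4)[OF _ s(2)]] r(1) s(1) by simp
    finally show ?thesis using mult_notin_P[OF r(1) s(1)] c by (auto simp: rank_closure_def)
  qed
  show "a \<odot>\<^bsub>M\<^esub> x \<in> rank_closure X" if ax: "a \<in> carrier R" "x \<in> rank_closure X" for a x
  proof -
    obtain r where r: "r \<in> carrier R - P" "r \<odot>\<^bsub>M\<^esub> x \<in> mod_span R M X" and c: "x \<in> carrier M"
      using ax by (auto simp: rank_closure_def)
    have "r \<odot>\<^bsub>M\<^esub> (a \<odot>\<^bsub>M\<^esub> x) = a \<odot>\<^bsub>M\<^esub> (r \<odot>\<^bsub>M\<^esub> x)"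
      using r(1) ax(1) c R.m_comm[of r a] smult_assoc1[of r a x] smult_assoc1[of a r x] by simp
    then have "r \<odot>\<^bsub>M\<^esub> (a \<odot>\<^bsub>M\<^esub> x) \<in> mod_span R M X" using S(4)[OF ax(1) r(2)] by simp
    then show ?thesis using r(1) ax(1) c by (auto simp: rank_closure_def)
  qed
qed

lemma span_finitary:
  assumes X: "X \<subseteq> carrier M" and x: "x \<in> mod_span R M X"
  shows "\<exists>F \<in> Fpow X. x \<in> mod_span R M F"
proof -
  let ?L = "{z. \<exists>F \<in> Fpow X. z \<in> mod_span R M F}"
  have FM: "F \<subseteq> carrier M" if "F \<in> Fpow X" for F using that X by (auto simp: Fpow_def)
  note S = submoduleE[OF span_submodule[OF FM]]
  have "submodule ?L R M"
  proof (rule submoduleI')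
    show "?L \<subseteq> carrier M" using S(1) by blast
    show "?L \<noteq> {}" using S(2)[OF empty_in_Fpow] empty_in_Fpow by blast
    show "a \<oplus>\<^bsub>M\<^esub> b \<in> ?L" if ab: "a \<in> ?L" "b \<in> ?L" for a b
    proof -
      obtain F G where FG: "F \<in> Fpow X" "a \<in> mod_span R M F" "G \<in> Fpow X" "b \<in> mod_span R M G" using ab by blast
      have U: "F \<union> G \<in> Fpow X" using FG by (auto simp: Fpow_def)
      have "a \<in> mod_span R M (F \<union> G)" "b \<in> mod_span R M (F \<union> G)"
        using FG span_mono[of F "F \<union> G"] span_mono[of G "F \<union> G"] by blast+
      then show ?thesis using S(5)[OF U] U by blast
    qed
    show "a \<odot>\<^bsub>M\<^esub> z \<in> ?L" if "a \<in> carrier R" "z \<in> ?L" for a z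
      using that S(4) by blast
  qed
  moreover have "X \<subseteq> ?L"
  proof
    fix z assume "z \<in> X"
    then have "{z} \<in> Fpow X" "z \<in> mod_span R M {z}" using span_superset[of "{z}" R M] by (auto simp: Fpow_def)
    then show "z \<in> ?L" by blast
  qed
  ultimately show ?thesis using span_minimal x by blast
qed

lemma span_insert:
  assumes X: "insert x X \<subseteq> carrier M" and y: "y \<in> mod_span R M (insert x X)"
  obtains s z where "s \<in> carrier R" "z \<in> mod_span R M X" "y = s \<odot>\<^bsub>M\<^esub> x \<oplus>\<^bsub>M\<^esub> z"
proof -
  define L where "L = {s \<odot>\<^bsub>M\<^esub> x \<oplus>\<^bsub>M\<^esub> z | s z. s \<in> carrier R \<and> z \<in> mod_span R M X}"
  have XM: "X \<subseteq> carrier M" and x: "x \<in> carrier M" using X by auto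
  note S = submoduleE[OF span_submodule[OF XM]]
  have SM: "z \<in> carrier M" if "z \<in> mod_span R M X" for z using S(1) that by blast
  have S0: "\<zero>\<^bsub>M\<^esub> \<in> mod_span R M X" using S(2) S(4)[OF R.zero_closed] SM by fastforce
  have LI: "s \<odot>\<^bsub>M\<^esub> x \<oplus>\<^bsub>M\<^esub> z \<in> L" if "s \<in> carrier R" "z \<in> mod_span R M X" for s z
    using that by (auto simp: L_def)
  have LE: "\<exists>s z. s \<in> carrier R \<and> z \<in> mod_span R M X \<and> y = s \<odot>\<^bsub>M\<^esub> x \<oplus>\<^bsub>M\<^esub> z" if "y \<in> L" for y
    using that by (auto simp: L_def)
  have "submodule L R M"
  proof (rule submoduleI')
    show "L \<subseteq> carrier M" using x SM by (auto simp: L_def)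
    show "L \<noteq> {}" using LI[OF R.zero_closed S0] by blast
    show "a \<oplus>\<^bsub>M\<^esub> b \<in> L" if ab: "a \<in> L" "b \<in> L" for a b
    proof -
      obtain s z t w where 1: "s \<in> carrier R" "z \<in> mod_span R M X" "a = s \<odot>\<^bsub>M\<^esub> x \<oplus>\<^bsub>M\<^esub> z"
        "t \<in> carrier R" "w \<in> mod_span R M X" "b = t \<odot>\<^bsub>M\<^esub> x \<oplus>\<^bsub>M\<^esub> w" using LE[OF ab(1)] LE[OF ab(2)] by blast
      have "a \<oplus>\<^bsub>M\<^esub> b = (s \<oplus> t) \<odot>\<^bsub>M\<^esub> x \<oplus>\<^bsub>M\<^esub> (z \<oplus>\<^bsub>M\<^esub> w)"
        using 1 x SM by (simp add: smult_l_distr M.a_ac)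
      also have "\<dots> \<in> L" using 1 S(5) by (intro LI) auto
      finally show ?thesis .
    qed
    show "a \<odot>\<^bsub>M\<^esub> b \<in> L" if ab: "a \<in> carrier R" "b \<in> L" for a b
    proof -
      obtain s z where 1: "s \<in> carrier R" "z \<in> mod_span R M X" "b = s \<odot>\<^bsub>M\<^esub> x \<oplus>\<^bsub>M\<^esub> z" using LE[OF ab(2)] by blast
      have "a \<odot>\<^bsub>M\<^esub> b = (a \<otimes> s) \<odot>\<^bsub>M\<^esub> x \<oplus>\<^bsub>M\<^esub> a \<odot>\<^bsub>M\<^esub> z"
        using 1 x SM ab(1) by (simp add: smult_r_distr smult_assoc1)
      also have "\<dots> \<in> L" using 1 ab(1) S(4) by (intro LI) auto
      finally show ?thesis .
    qed
  qed
  moreover have "insert x X \<subseteq> L"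
  proof -
    have "x \<in> L" using LI[OF R.one_closed S0] x by simp
    moreover have "z \<in> L" if "z \<in> X" for z
    proof -
      have "z \<in> mod_span R M X" using that span_superset[of X R M] by blast
      then show ?thesis using LI[OF R.zero_closed, of z] x SM by simp
    qed
    ultimately show ?thesis by blast
  qed
  ultimately have "mod_span R M (insert x X) \<subseteq> L" by (rule span_minimal)
  then show thesis using LE[of y] y that by blast
qed

text \<open>Exchange rests on \<open>P M = 0\<close>: in a relation \<open>r y = s x + z\<close> with \<open>z\<close> in
  the span of \<open>X\<close>, a coefficient \<open>s\<close> in \<open>P\<close> would make \<open>y\<close> depend on \<open>X\<close> alone.\<close>

lemma rank_pregeometry: "pregeometry (carrier M) rank_closure"
proof
  show "rank_closure X \<subseteq> carrier M" for X by (auto simp: rank_closure_def)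
  show "X \<subseteq> rank_closure X" if "X \<subseteq> carrier M" for X
    using rank_closure_superset[OF that] span_superset[of X R M] by blast
  show "rank_closure X \<subseteq> rank_closure Y" if XY: "X \<subseteq> rank_closure Y" "Y \<subseteq> carrier M" for X Y
  proof
    fix x assume "x \<in> rank_closure X"
    then obtain r where r: "x \<in> carrier M" "r \<in> carrier R - P" "r \<odot>\<^bsub>M\<^esub> x \<in> mod_span R M X"
      by (auto simp: rank_closure_def)
    have "r \<odot>\<^bsub>M\<^esub> x \<in> rank_closure Y"
      using span_minimal[OF rank_closure_submodule[OF XY(2)] XY(1)] r(3) by blast
    then obtain s where s: "s \<in> carrier R - P" "s \<odot>\<^bsub>M\<^esub> (r \<odot>\<^bsub>M\<^esub> x) \<in> mod_span R M Y"
      by (auto simp: rank_closure_def)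
    then have "(s \<otimes> r) \<odot>\<^bsub>M\<^esub> x \<in> mod_span R M Y" using r(1,2) by (simp add: smult_assoc1)
    then show "x \<in> rank_closure Y" using mult_notin_P[OF s(1) r(2)] r(1) by (auto simp: rank_closure_def)
  qed
  show "\<exists>F\<in>Fpow X. x \<in> rank_closure F" if "X \<subseteq> carrier M" "x \<in> rank_closure X" for x X
    using that span_finitary[OF that(1)] by (fastforce simp: rank_closure_def)
  show "x \<in> rank_closure (insert y X)"
    if c: "insert x (insert y X) \<subseteq> carrier M" and y: "y \<in> rank_closure (insert x X)" "y \<notin> rank_closure X"
    for x y X
  proof -
    have cc: "x \<in> carrier M" "y \<in> carrier M" "X \<subseteq> carrier M" "insert x X \<subseteq> carrier M" "insert y X \<subseteq> carrier M"
      using c by auto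
    obtain r where r: "r \<in> carrier R - P" "r \<odot>\<^bsub>M\<^esub> y \<in> mod_span R M (insert x X)"
      using y(1) by (auto simp: rank_closure_def)
    obtain s z where sz: "s \<in> carrier R" "z \<in> mod_span R M X" "r \<odot>\<^bsub>M\<^esub> y = s \<odot>\<^bsub>M\<^esub> x \<oplus>\<^bsub>M\<^esub> z"
      using span_insert[OF cc(4) r(2)] by blast
    have zM: "z \<in> carrier M" using submoduleE(1)[OF span_submodule[OF cc(3)]] sz(2) by blast
    have "s \<notin> P"
    proof
      assume "s \<in> P"
      then have "r \<odot>\<^bsub>M\<^esub> y = z" using sz(3) annihilated[of s x] cc(1) zM by simp
      then show False using y(2) r(1) sz(2) cc(2) by (auto simp: rank_closure_def)
    qed
    have "s \<odot>\<^bsub>M\<^esub> x = r \<odot>\<^bsub>M\<^esub> y \<oplus>\<^bsub>M\<^esub> \<ominus>\<^bsub>M\<^esub> z"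
      using sz(1,3) cc(1) zM by (simp add: M.a_assoc M.r_neg)
    also have "\<dots> \<in> mod_span R M (insert y X)"
    proof -
      note S = submoduleE[OF span_submodule[OF cc(5)]]
      have "y \<in> mod_span R M (insert y X)" "z \<in> mod_span R M (insert y X)"
        using span_superset[of "insert y X" R M] span_mono[of X "insert y X" R M] sz(2) by blast+
      then show ?thesis using S(3,4,5) r(1) by blast
    qed
    finally show ?thesis using \<open>s \<notin> P\<close> sz(1) cc(1) by (auto simp: rank_closure_def)
  qed
qed

sublocale rank: pregeometry "carrier M" rank_closure by (rule rank_pregeometry)

end

section \<open>Rank of the bidual\<close>

context matlis_duality
begin

text \<open>The elements of \<open>E\<close> killed by \<open>P\<close> form a faithful module over \<open>R / P\<close>, being the dual of \<open>R / P\<close>: a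
  functional on \<open>R\<close> that vanishes on \<open>P\<close> but not at \<open>r\<close> gives \<open>e\<close> as its value at \<open>1\<close>.\<close>

lemma faithful_modulo_ideal:
  assumes "ideal P R" "r \<in> carrier R" "r \<notin> P"
  obtains e where "e \<in> carrier E" "\<And>s. s \<in> P \<Longrightarrow> s \<odot>\<^bsub>E\<^esub> e = \<zero>\<^bsub>E\<^esub>" "r \<odot>\<^bsub>E\<^esub> e \<noteq> \<zero>\<^bsub>E\<^esub>"
proof -
  interpret P: ideal P R by fact
  let ?R = "ring_module R"
  have RM: "module R ?R" by (rule ring_module_is_module[OF is_cring])
  interpret RM: module R ?R by (rule RM)
  have rs [simp]: "carrier ?R = carrier R" "smult ?R = mult R" "add ?R = add R"
    by (simp_all add: ring_module_def)
  have "submodule P R ?R"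
  proof (rule RM.submoduleI')
    show "P \<subseteq> carrier ?R" using P.a_subset by simp
    show "P \<noteq> {}" using additive_subgroup.zero_closed[OF P.additive_subgroup_axioms] by blast
    show "a \<oplus>\<^bsub>?R\<^esub> b \<in> P" if "a \<in> P" "b \<in> P" for a b using that by simp
    show "a \<odot>\<^bsub>?R\<^esub> x \<in> P" if "a \<in> carrier R" "x \<in> P" for a x using that P.I_l_closed by simp
  qed
  then obtain n where n: "n \<in> mod_hom R ?R E" "n r \<noteq> \<zero>\<^bsub>E\<^esub>" "\<forall>y\<in>P. n y = \<zero>\<^bsub>E\<^esub>"
    using separation[OF RM, of P r] assms by auto
  have n1: "s \<odot>\<^bsub>E\<^esub> n \<one> = n s" if "s \<in> carrier R" for s
    using mod_homD(3)[OF n(1) that, of \<one>] that by simp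
  show thesis
    by (rule that[of "n \<one>"]) (use n1 n(2,3) assms(2) P.a_Hcarr mod_homD(1)[OF n(1)] in auto)
qed

lemma dual_element:
  assumes PM: "prime_annihilated_module R M P"
    and B: "pregeometry.independent (carrier M) (prime_annihilated_module.rank_closure R M P) B"
    and b: "b \<in> B" and e: "e \<in> carrier E" "\<And>s. s \<in> P \<Longrightarrow> s \<odot>\<^bsub>E\<^esub> e = \<zero>\<^bsub>E\<^esub>"
  obtains n where "n \<in> mod_hom R M E" "n b = e" "\<And>b'. b' \<in> B - {b} \<Longrightarrow> n b' = \<zero>\<^bsub>E\<^esub>"
proof -
  interpret PM: prime_annihilated_module R M P by (rule PM)
  have BM: "b \<in> carrier M" "B - {b} \<subseteq> carrier M" "b \<notin> PM.rank_closure (B - {b})"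
    using B b by (auto simp: PM.rank.independent_def)
  have "r \<odot>\<^bsub>E\<^esub> e = \<zero>\<^bsub>E\<^esub>" if "r \<in> carrier R" "r \<odot>\<^bsub>M\<^esub> b \<in> mod_span R M (B - {b})" for r
    using that BM(1,3) e(2)[of r] by (auto simp: PM.rank_closure_def)
  then obtain n where "n \<in> mod_hom R M E" "n b = e" "\<forall>x\<in>mod_span R M (B - {b}). n x = \<zero>\<^bsub>E\<^esub>"
    using extend_by_element[OF PM.module_axioms PM.span_submodule[OF BM(2)] BM(1) e(1)] by blast
  moreover have "B - {b} \<subseteq> mod_span R M (B - {b})" by (rule span_superset)
  ultimately show thesis using that by blast
qed

text \<open>The functional sends \<open>n\<close> to the sum of the values \<open>n b\<close> over \<open>b\<close> in \<open>B \<inter> X\<close>. This makes sense when \<open>n\<close>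
  has finite support on \<open>B\<close>; injectivity of \<open>E\<close> extends it to all of \<open>M\<^sup>\<circ>\<close>.\<close>

lemma selector:
  assumes M: "module R M" and B: "B \<subseteq> carrier M"
  shows "\<exists>h \<in> mod_hom R (Hom_module R M E) E. \<forall>b\<in>B. \<forall>n\<in>mod_hom R M E.
    (\<forall>b'\<in>B - {b}. n b' = \<zero>\<^bsub>E\<^esub>) \<longrightarrow> h n = (if b \<in> X then n b else \<zero>\<^bsub>E\<^esub>)"
proof -
  let ?D = "Hom_module R M E"
  interpret D: module R ?D by (rule Hom_module_is_module[OF M module_E])
  define G where "G = {(n, \<Oplus>\<^bsub>E\<^esub>b\<in>T \<inter> X. n b) | n T. n \<in> mod_hom R M E \<and> T \<in> Fpow B \<and> (\<forall>b\<in>B - T. n b = \<zero>\<^bsub>E\<^esub>)}"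
  have GI: "(n, \<Oplus>\<^bsub>E\<^esub>b\<in>T \<inter> X. n b) \<in> G"
    if "n \<in> mod_hom R M E" "T \<in> Fpow B" "\<And>b. b \<in> B - T \<Longrightarrow> n b = \<zero>\<^bsub>E\<^esub>" for n T
    using that by (auto simp: G_def)
  have GE: "\<exists>T. n \<in> mod_hom R M E \<and> T \<in> Fpow B \<and> (\<forall>b\<in>B - T. n b = \<zero>\<^bsub>E\<^esub>) \<and> s = (\<Oplus>\<^bsub>E\<^esub>b\<in>T \<inter> X. n b)"
    if "(n, s) \<in> G" for n s using that by (auto simp: G_def)
  have nE: "n b \<in> carrier E" if "n \<in> mod_hom R M E" "b \<in> B" for n b
    using mod_homD(1)[OF that(1)] that(2) B by blast
  have nE': "n \<in> T \<inter> X \<rightarrow> carrier E" if "n \<in> mod_hom R M E" "T \<in> Fpow B" for n T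
    using that nE by (auto simp: Fpow_def)
  \<comment> \<open>The finite set \<open>T\<close> that contains the support is not unique; enlarging it does not change the sum.\<close>
  have enlarge: "(\<Oplus>\<^bsub>E\<^esub>b\<in>T \<inter> X. n b) = (\<Oplus>\<^bsub>E\<^esub>b\<in>T' \<inter> X. n b)"
    if "n \<in> mod_hom R M E" "T' \<in> Fpow B" "T \<subseteq> T'" "\<And>b. b \<in> B - T \<Longrightarrow> n b = \<zero>\<^bsub>E\<^esub>" for n T T'
  proof (rule E.M.add.finprod_mono_neutral_cong_left)
    show "finite (T' \<inter> X)" "T \<inter> X \<subseteq> T' \<inter> X" using that(2,3) by (auto simp: Fpow_def)
    show "n b = \<zero>\<^bsub>E\<^esub>" if "b \<in> T' \<inter> X - T \<inter> X" for b
      using that \<open>T' \<in> Fpow B\<close> \<open>\<And>b. b \<in> B - T \<Longrightarrow> n b = \<zero>\<^bsub>E\<^esub>\<close> by (auto simp: Fpow_def)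
    show "n \<in> T' \<inter> X \<rightarrow> carrier E" by (rule nE'[OF that(1,2)])
  qed simp
  have "\<exists>h \<in> mod_hom R ?D E. \<forall>n s. (n, s) \<in> G \<longrightarrow> h n = s"
  proof (rule extend_relation[OF D.module_axioms])
    show "G \<subseteq> carrier ?D \<times> carrier E"
      using nE' by (auto simp: G_def intro!: E.M.finsum_closed)
    have "(\<zero>\<^bsub>?D\<^esub>, \<Oplus>\<^bsub>E\<^esub>b\<in>{} \<inter> X. \<zero>\<^bsub>?D\<^esub> b) \<in> G"
      using D.M.zero_closed B by (intro GI) (auto simp: Fpow_def)
    then show "G \<noteq> {}" by blast
    show "(n \<oplus>\<^bsub>?D\<^esub> k, s \<oplus>\<^bsub>E\<^esub> t) \<in> G" if nk: "(n, s) \<in> G" "(k, t) \<in> G" for n s k t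
    proof -
      obtain T where T: "n \<in> mod_hom R M E" "T \<in> Fpow B" "\<forall>b\<in>B - T. n b = \<zero>\<^bsub>E\<^esub>" "s = (\<Oplus>\<^bsub>E\<^esub>b\<in>T \<inter> X. n b)"
        using GE[OF nk(1)] by blast
      obtain T' where T': "k \<in> mod_hom R M E" "T' \<in> Fpow B" "\<forall>b\<in>B - T'. k b = \<zero>\<^bsub>E\<^esub>" "t = (\<Oplus>\<^bsub>E\<^esub>b\<in>T' \<inter> X. k b)"
        using GE[OF nk(2)] by blast
      let ?U = "T \<union> T'"
      have U: "?U \<in> Fpow B" "?U \<inter> X \<subseteq> carrier M" using T(2) T'(2) B by (auto simp: Fpow_def)
      have "s \<oplus>\<^bsub>E\<^esub> t = (\<Oplus>\<^bsub>E\<^esub>b\<in>?U \<inter> X. n b) \<oplus>\<^bsub>E\<^esub> (\<Oplus>\<^bsub>E\<^esub>b\<in>?U \<inter> X. k b)"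
        using enlarge[OF T(1) U(1), of T] enlarge[OF T'(1) U(1), of T'] T T' by simp
      also have "\<dots> = (\<Oplus>\<^bsub>E\<^esub>b\<in>?U \<inter> X. n b \<oplus>\<^bsub>E\<^esub> k b)"
        using E.M.finsum_addf[OF nE'[OF T(1) U(1)] nE'[OF T'(1) U(1)]] by simp
      also have "\<dots> = (\<Oplus>\<^bsub>E\<^esub>b\<in>?U \<inter> X. (n \<oplus>\<^bsub>?D\<^esub> k) b)"
      proof (rule sym, rule E.M.finsum_cong'[OF refl])
        show "(\<lambda>b. n b \<oplus>\<^bsub>E\<^esub> k b) \<in> ?U \<inter> X \<rightarrow> carrier E"
          using nE'[OF T(1) U(1)] nE'[OF T'(1) U(1)] by (simp add: Pi_iff)
        show "(n \<oplus>\<^bsub>?D\<^esub> k) b = n b \<oplus>\<^bsub>E\<^esub> k b" if "b \<in> ?U \<inter> X" for b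
          using U(2) that by (intro Hom_module_apply(1)) blast
      qed
      finally have st: "s \<oplus>\<^bsub>E\<^esub> t = (\<Oplus>\<^bsub>E\<^esub>b\<in>?U \<inter> X. (n \<oplus>\<^bsub>?D\<^esub> k) b)" .
      have "n \<oplus>\<^bsub>?D\<^esub> k \<in> mod_hom R M E" using D.M.add.m_closed[of n k] T(1) T'(1) by simp
      moreover have "(n \<oplus>\<^bsub>?D\<^esub> k) b = \<zero>\<^bsub>E\<^esub>" if "b \<in> B - ?U" for b
        using that T(3) T'(3) B by auto
      ultimately show ?thesis unfolding st using U(1) by (intro GI) auto
    qed
    show "(r \<odot>\<^bsub>?D\<^esub> n, r \<odot>\<^bsub>E\<^esub> s) \<in> G" if r: "r \<in> carrier R" and ns: "(n, s) \<in> G" for r n s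
    proof -
      obtain T where T: "n \<in> mod_hom R M E" "T \<in> Fpow B" "\<forall>b\<in>B - T. n b = \<zero>\<^bsub>E\<^esub>" "s = (\<Oplus>\<^bsub>E\<^esub>b\<in>T \<inter> X. n b)"
        using GE[OF ns] by blast
      have TM: "finite (T \<inter> X)" "T \<inter> X \<subseteq> carrier M" using T(2) B by (auto simp: Fpow_def)
      have "r \<odot>\<^bsub>E\<^esub> s = (\<Oplus>\<^bsub>E\<^esub>b\<in>T \<inter> X. r \<odot>\<^bsub>E\<^esub> n b)"
        unfolding T(4) by (rule E.finsum_smult_ldistr[OF TM(1) r nE'[OF T(1,2)]])
      also have "\<dots> = (\<Oplus>\<^bsub>E\<^esub>b\<in>T \<inter> X. (r \<odot>\<^bsub>?D\<^esub> n) b)"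
      proof (rule sym, rule E.M.finsum_cong'[OF refl])
        show "(\<lambda>b. r \<odot>\<^bsub>E\<^esub> n b) \<in> T \<inter> X \<rightarrow> carrier E"
          using nE'[OF T(1,2)] r by (simp add: Pi_iff)
        show "(r \<odot>\<^bsub>?D\<^esub> n) b = r \<odot>\<^bsub>E\<^esub> n b" if "b \<in> T \<inter> X" for b
          using TM(2) that by (intro Hom_module_apply(2)) blast
      qed
      finally have s: "r \<odot>\<^bsub>E\<^esub> s = (\<Oplus>\<^bsub>E\<^esub>b\<in>T \<inter> X. (r \<odot>\<^bsub>?D\<^esub> n) b)" .
      have "r \<odot>\<^bsub>?D\<^esub> n \<in> mod_hom R M E" using D.smult_closed[OF r, of n] T(1) by simp
      moreover have "(r \<odot>\<^bsub>?D\<^esub> n) b = \<zero>\<^bsub>E\<^esub>" if "b \<in> B - T" for b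
        using that T(3) B r by auto
      ultimately show ?thesis unfolding s using T(2) by (intro GI) auto
    qed
    show "s = \<zero>\<^bsub>E\<^esub>" if z: "(\<zero>\<^bsub>?D\<^esub>, s) \<in> G" for s
    proof -
      obtain T where T: "T \<in> Fpow B" "s = (\<Oplus>\<^bsub>E\<^esub>b\<in>T \<inter> X. \<zero>\<^bsub>?D\<^esub> b)"
        using GE[OF z] by blast
      show ?thesis unfolding T(2)
        using T(1) B by (intro E.M.add.finprod_one_eqI) (auto simp: Fpow_def)
    qed
  qed
  then obtain h where h: "h \<in> mod_hom R ?D E" "\<And>n s. (n, s) \<in> G \<Longrightarrow> h n = s" by blast
  have "h n = (if b \<in> X then n b else \<zero>\<^bsub>E\<^esub>)"
    if b: "b \<in> B" and n: "n \<in> mod_hom R M E" "\<forall>b'\<in>B - {b}. n b' = \<zero>\<^bsub>E\<^esub>" for b n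
  proof -
    have "(n, \<Oplus>\<^bsub>E\<^esub>b\<in>{b} \<inter> X. n b) \<in> G" using n b by (intro GI) (auto simp: Fpow_def)
    then have "h n = (\<Oplus>\<^bsub>E\<^esub>b\<in>{b} \<inter> X. n b)" by (rule h(2))
    then show ?thesis using nE[OF n(1) b] by (cases "b \<in> X") auto
  qed
  then show ?thesis using h(1) by blast
qed

lemma canonical_map_inj:
  assumes M: "module R M"
  shows "inj_on (canonical_map R E M) (carrier M)"
proof (rule inj_onI)
  interpret M: module R M by (rule M)
  fix x y assume xy: "x \<in> carrier M" "y \<in> carrier M" "canonical_map R E M x = canonical_map R E M y"
  have eq: "n x = n y" if "n \<in> mod_hom R M E" for n
    using canonical_map_apply[OF xy(1) that] canonical_map_apply[OF xy(2) that] xy(3) by simp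
  show "x = y"
  proof (rule ccontr)
    assume "x \<noteq> y"
    then have "x \<oplus>\<^bsub>M\<^esub> \<ominus>\<^bsub>M\<^esub> y \<notin> {\<zero>\<^bsub>M\<^esub>}" using xy(1,2) M.M.add.inv_solve_right' by auto
    then obtain n where n: "n \<in> mod_hom R M E" "n (x \<oplus>\<^bsub>M\<^esub> \<ominus>\<^bsub>M\<^esub> y) \<noteq> \<zero>\<^bsub>E\<^esub>"
      using separation[OF M M.submodule_zero, of "x \<oplus>\<^bsub>M\<^esub> \<ominus>\<^bsub>M\<^esub> y"] xy(1,2) by blast
    have "n (x \<oplus>\<^bsub>M\<^esub> \<ominus>\<^bsub>M\<^esub> y) = n x \<oplus>\<^bsub>E\<^esub> \<ominus>\<^bsub>E\<^esub> n y"
      using mod_homD(2)[OF n(1)] mod_hom_minus[OF M module_E n(1)] xy(1,2) by simp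
    then show False using n eq[OF n(1)] mod_homD(1)[OF n(1) xy(2)] by (simp add: E.M.r_neg)
  qed
qed

text \<open>The family consists of the selectors for the sets \<open>X S\<close> of \<open>separating_family\<close>, mapped to \<open>M\<close> by \<open>u\<close>.
  A combination of finitely many selectors other than that of \<open>S\<close> vanishes on functionals concentrated
  at a point \<open>b\<close> that belongs to \<open>X S\<close> only, whereas \<open>r\<close> times the selector of \<open>S\<close> takes there the
  value \<open>r e\<close>, where \<open>e\<close> is any element of \<open>E\<close> killed by \<open>P\<close>. This forces \<open>r\<close> into \<open>P\<close>.\<close>

lemma bidual_family_independent:
  assumes PM: "prime_annihilated_module R M P"
    and B: "pregeometry.independent (carrier M) (prime_annihilated_module.rank_closure R M P) B"
    and inf: "infinite B"
    and u: "u \<in> mod_mono R (matlis_bidual R E M) M"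
  shows "\<exists>c. inj_on c (Pow B) \<and>
    pregeometry.independent (carrier M) (prime_annihilated_module.rank_closure R M P) (c ` Pow B)"
proof -
  interpret PM: prime_annihilated_module R M P by (rule PM)
  let ?D = "Hom_module R M E" and ?DD = "matlis_bidual R E M"
  have M: "module R M" by (rule PM.module_axioms)
  interpret D: module R ?D by (rule Hom_module_is_module[OF M module_E])
  interpret DD: module R ?DD by (rule Hom_module_is_module[OF D.module_axioms module_E])
  have uh: "u \<in> mod_hom R ?DD M" and ui: "inj_on u (mod_hom R ?D E)"
    using u by (auto simp: mod_mono_def)
  have BM: "B \<subseteq> carrier M" using B by (simp add: PM.rank.independent_def)
  obtain X where "\<forall>S\<in>Pow B. \<forall>T. finite T \<longrightarrow> T \<subseteq> Pow B - {S} \<longrightarrow> (\<exists>b\<in>B. b \<in> X S \<and> (\<forall>S'\<in>T. b \<notin> X S'))"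
    using separating_family[OF inf] ..
  then have X: "\<exists>b\<in>B. b \<in> X S \<and> (\<forall>S'\<in>T. b \<notin> X S')"
    if "S \<in> Pow B" "finite T" "T \<subseteq> Pow B - {S}" for S T
    using that by simp
  define supp where "supp b = {n \<in> mod_hom R M E. \<forall>b'\<in>B - {b}. n b' = \<zero>\<^bsub>E\<^esub>}" for b
  have "\<exists>h. h \<in> mod_hom R ?D E \<and> (\<forall>b\<in>B. \<forall>n\<in>supp b. h n = (if b \<in> X S then n b else \<zero>\<^bsub>E\<^esub>))" for S
  proof -
    obtain h where "h \<in> mod_hom R ?D E" "\<forall>b\<in>B. \<forall>n\<in>mod_hom R M E.
        (\<forall>b'\<in>B - {b}. n b' = \<zero>\<^bsub>E\<^esub>) \<longrightarrow> h n = (if b \<in> X S then n b else \<zero>\<^bsub>E\<^esub>)"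
      using selector[OF M BM, of "X S"] by (elim bexE)
    then show ?thesis by (intro exI[of _ h]) (simp add: supp_def)
  qed
  then have "\<exists>h. \<forall>S. h S \<in> mod_hom R ?D E \<and> (\<forall>b\<in>B. \<forall>n\<in>supp b. h S n = (if b \<in> X S then n b else \<zero>\<^bsub>E\<^esub>))"
    by (intro choice allI)
  then obtain h where h0: "\<forall>S. h S \<in> mod_hom R ?D E \<and> (\<forall>b\<in>B. \<forall>n\<in>supp b. h S n = (if b \<in> X S then n b else \<zero>\<^bsub>E\<^esub>))" ..
  have h: "h S \<in> mod_hom R ?D E"
    "b \<in> B \<Longrightarrow> n \<in> supp b \<Longrightarrow> h S n = (if b \<in> X S then n b else \<zero>\<^bsub>E\<^esub>)" for S b n
    using h0 by simp_all
  have suppD: "n \<in> mod_hom R M E" if "n \<in> supp b" for n b using that by (simp add: supp_def)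
  \<comment> \<open>\<open>W S\<close> is a submodule that contains all selectors except that of \<open>S\<close>; it replaces their span, so
    that no linear combinations have to be written down.\<close>
  define van where "van T = {z \<in> mod_hom R ?D E. \<forall>b\<in>B. (\<forall>S'\<in>T. b \<notin> X S') \<longrightarrow> (\<forall>n\<in>supp b. z n = \<zero>\<^bsub>E\<^esub>)}" for T
  define W where "W S = {z. \<exists>T. finite T \<and> T \<subseteq> Pow B - {S} \<and> z \<in> van T}" for S
  have van_mono: "z \<in> van T'" if "z \<in> van T" "T \<subseteq> T'" for z T T' using that by (auto simp: van_def)
  have W: "submodule (W S) R ?DD" for S
  proof (rule DD.submoduleI')
    show "W S \<subseteq> carrier ?DD" by (auto simp: W_def van_def)
    have "\<zero>\<^bsub>?DD\<^esub> \<in> van {}" using DD.M.zero_closed suppD by (simp add: van_def)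
    then show "W S \<noteq> {}" by (auto simp: W_def)
    show "y \<oplus>\<^bsub>?DD\<^esub> z \<in> W S" if yz: "y \<in> W S" "z \<in> W S" for y z
    proof -
      obtain T T' where T: "finite T" "T \<subseteq> Pow B - {S}" "y \<in> van T"
        and T': "finite T'" "T' \<subseteq> Pow B - {S}" "z \<in> van T'" using yz by (auto simp: W_def)
      have "y \<in> van (T \<union> T')" "z \<in> van (T \<union> T')" using van_mono T(3) T'(3) by blast+
      then have "y \<oplus>\<^bsub>?DD\<^esub> z \<in> van (T \<union> T')"
        using DD.M.add.m_closed[of y z] suppD by (auto simp: van_def)
      then show ?thesis using T T' unfolding W_def by (intro CollectI exI[of _ "T \<union> T'"]) auto
    qed
    show "r \<odot>\<^bsub>?DD\<^esub> z \<in> W S" if rz: "r \<in> carrier R" "z \<in> W S" for r z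
    proof -
      obtain T where T: "finite T" "T \<subseteq> Pow B - {S}" "z \<in> van T" using rz by (auto simp: W_def)
      have "r \<odot>\<^bsub>?DD\<^esub> z \<in> van T"
        using T(3) rz(1) DD.smult_closed[of r z] suppD by (auto simp: van_def)
      then show ?thesis using T by (auto simp: W_def)
    qed
  qed
  have hW: "h S' \<in> W S" if "S' \<in> Pow B" "S' \<noteq> S" for S S'
  proof -
    have "h S' \<in> van {S'}" using h by (auto simp: van_def)
    then show ?thesis using that unfolding W_def by (intro CollectI exI[of _ "{S'}"]) auto
  qed
  have key: "r \<in> P" if S: "S \<in> Pow B" and r: "r \<in> carrier R" "r \<odot>\<^bsub>?DD\<^esub> h S \<in> W S" for r S
  proof (rule ccontr)
    assume "r \<notin> P"
    then obtain e where e: "e \<in> carrier E" "\<And>s. s \<in> P \<Longrightarrow> s \<odot>\<^bsub>E\<^esub> e = \<zero>\<^bsub>E\<^esub>" "r \<odot>\<^bsub>E\<^esub> e \<noteq> \<zero>\<^bsub>E\<^esub>"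
      using faithful_modulo_ideal[OF PM.is_ideal r(1)] by blast
    obtain T where T: "finite T" "T \<subseteq> Pow B - {S}" "r \<odot>\<^bsub>?DD\<^esub> h S \<in> van T"
      using r(2) by (auto simp: W_def)
    obtain b where b: "b \<in> B" "b \<in> X S" "\<forall>S'\<in>T. b \<notin> X S'" using X[OF S T(1,2)] by blast
    obtain n where n: "n \<in> mod_hom R M E" "n b = e" "\<And>b'. b' \<in> B - {b} \<Longrightarrow> n b' = \<zero>\<^bsub>E\<^esub>"
      using dual_element[OF PM B b(1) e(1,2)] by blast
    then have ns: "n \<in> supp b" by (simp add: supp_def)
    have "(r \<odot>\<^bsub>?DD\<^esub> h S) n = \<zero>\<^bsub>E\<^esub>" using T(3) b(1,3) ns by (simp add: van_def)
    then show False using h(2)[OF b(1) ns, of S] b(2) n e(3) by simp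
  qed
  have ne: "h S \<noteq> h S'" if "S \<in> Pow B" "S' \<in> Pow B" "S \<noteq> S'" for S S'
  proof
    assume "h S = h S'"
    then have "\<one> \<odot>\<^bsub>?DD\<^esub> h S \<in> W S" using hW[of S' S] that h(1)[of S'] by simp
    then show False using key[OF that(1) one_closed] PM.one_notin_P by blast
  qed
  define c where "c S = u (h S)" for S
  have cinj: "inj_on c (Pow B)"
  proof (rule inj_onI)
    fix S S' assume S: "S \<in> Pow B" "S' \<in> Pow B" "c S = c S'"
    then have "h S = h S'" using inj_onD[OF ui _ h(1) h(1)] by (simp add: c_def)
    then show "S = S'" using ne S by blast
  qed
  have cM: "c S \<in> carrier M" for S using mod_homD(1)[OF uh] h(1) by (simp add: c_def)
  have "c S \<notin> PM.rank_closure (c ` Pow B - {c S})" if S: "S \<in> Pow B" for S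
  proof
    assume "c S \<in> PM.rank_closure (c ` Pow B - {c S})"
    then obtain r where r: "r \<in> carrier R" "r \<notin> P" "r \<odot>\<^bsub>M\<^esub> c S \<in> mod_span R M (c ` Pow B - {c S})"
      by (auto simp: PM.rank_closure_def)
    have "c ` Pow B - {c S} \<subseteq> u ` W S"
    proof
      fix y assume "y \<in> c ` Pow B - {c S}"
      then obtain S' where "S' \<in> Pow B" "S' \<noteq> S" "y = u (h S')" by (auto simp: c_def)
      then show "y \<in> u ` W S" using hW by blast
    qed
    then have "mod_span R M (c ` Pow B - {c S}) \<subseteq> u ` W S"
      by (rule span_minimal[OF image_submodule[OF DD.module_axioms M uh W]])
    then obtain w where w: "w \<in> W S" "r \<odot>\<^bsub>M\<^esub> c S = u w" using r(3) by blast
    have "u (r \<odot>\<^bsub>?DD\<^esub> h S) = u w"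
      using w(2) mod_homD(3)[OF uh r(1), of "h S"] h(1) by (simp add: c_def)
    moreover have "r \<odot>\<^bsub>?DD\<^esub> h S \<in> mod_hom R ?D E" using DD.smult_closed[OF r(1), of "h S"] h(1) by simp
    moreover have "w \<in> mod_hom R ?D E" using w(1) by (auto simp: W_def van_def)
    ultimately have "r \<odot>\<^bsub>?DD\<^esub> h S = w" by (rule inj_onD[OF ui])
    then show False using key[OF S r(1)] w(1) r(2) by blast
  qed
  then have "PM.rank.independent (c ` Pow B)" using cM by (auto simp: PM.rank.independent_def)
  then show ?thesis using cinj by blast
qed

text \<open>An embedding of the bidual forces the rank of \<open>M\<close> to be finite. Then \<open>\<psi>\<close>, the canonical map followed
  by the embedding, preserves independence and hence maps a basis to a basis, and a dependence of
  \<open>u f\<close> on that basis pulls back along \<open>u\<close> to the bidual.\<close>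

lemma cokernel_torsion:
  assumes PM: "prime_annihilated_module R M P"
    and u: "u \<in> mod_mono R (matlis_bidual R E M) M"
    and f: "f \<in> mod_hom R (Hom_module R M E) E"
  obtains r x where "r \<in> carrier R" "r \<notin> P" "x \<in> carrier M"
    "\<And>n. n \<in> mod_hom R M E \<Longrightarrow> r \<odot>\<^bsub>E\<^esub> f n = n x"
proof -
  interpret PM: prime_annihilated_module R M P by (rule PM)
  let ?D = "Hom_module R M E" and ?DD = "matlis_bidual R E M"
  have M: "module R M" by (rule PM.module_axioms)
  interpret D: module R ?D by (rule Hom_module_is_module[OF M module_E])
  interpret DD: module R ?DD by (rule Hom_module_is_module[OF D.module_axioms module_E])
  have uh: "u \<in> mod_hom R ?DD M" and ui: "inj_on u (mod_hom R ?D E)"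
    using u by (auto simp: mod_mono_def)
  obtain B where B: "PM.rank.independent B" "PM.rank_closure B = carrier M"
    using PM.rank.basis_exists by blast
  have BM: "B \<subseteq> carrier M" using B(1) by (simp add: PM.rank.independent_def)
  have "finite B"
  proof (rule ccontr)
    assume inf: "infinite B"
    obtain c where c: "inj_on c (Pow B)" "PM.rank.independent (c ` Pow B)"
      using bidual_family_independent[OF PM B(1) inf u] by blast
    have "c ` Pow B \<subseteq> PM.rank_closure B" using c(2) B(2) by (simp add: PM.rank.independent_def)
    then have "c ` Pow B \<lesssim> B" by (rule PM.rank.independent_lepoll_infinite[OF inf BM c(2)])
    then have "Pow B \<lesssim> B" using c(1) by simp
    then show False using lesspoll_Pow_self lesspoll_trans1 lesspoll_not_refl by metis
  qed
  define \<psi> where "\<psi> = (\<lambda>x\<in>carrier M. u (canonical_map R E M x))"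
  have ch: "canonical_map R E M \<in> mod_hom R M ?DD" by (rule canonical_map_hom[OF M module_E])
  note cD = mod_homD(1)[OF ch, unfolded carrier_Hom_module]
  have \<psi>h: "\<psi> \<in> mod_hom R M M" unfolding \<psi>_def by (rule restrict_comp_hom[OF ch uh M])
  have \<psi>i: "inj_on \<psi> (carrier M)"
  proof (rule inj_onI)
    fix x y assume xy: "x \<in> carrier M" "y \<in> carrier M" "\<psi> x = \<psi> y"
    then have "canonical_map R E M x = canonical_map R E M y"
      using inj_onD[OF ui _ cD cD] by (simp add: \<psi>_def)
    then show "x = y" by (rule inj_onD[OF canonical_map_inj[OF M] _ xy(1,2)])
  qed
  have "\<psi> b \<notin> PM.rank_closure (\<psi> ` B - {\<psi> b})" if b: "b \<in> B" for b
  proof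
    assume "\<psi> b \<in> PM.rank_closure (\<psi> ` B - {\<psi> b})"
    then obtain r where r: "r \<in> carrier R" "r \<notin> P" "r \<odot>\<^bsub>M\<^esub> \<psi> b \<in> mod_span R M (\<psi> ` B - {\<psi> b})"
      by (auto simp: PM.rank_closure_def)
    have bM: "b \<in> carrier M" and BbM: "B - {b} \<subseteq> carrier M" using b BM by auto
    have "\<psi> ` B - {\<psi> b} \<subseteq> \<psi> ` (B - {b})" by blast
    then have "r \<odot>\<^bsub>M\<^esub> \<psi> b \<in> \<psi> ` mod_span R M (B - {b})"
      using r(3) span_mono[of "\<psi> ` B - {\<psi> b}" "\<psi> ` (B - {b})" R M] span_image_subset[OF M M \<psi>h BbM] by blast
    then obtain z where z: "z \<in> mod_span R M (B - {b})" "r \<odot>\<^bsub>M\<^esub> \<psi> b = \<psi> z" by blast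
    have zM: "z \<in> carrier M" using z(1) PM.submoduleE(1)[OF PM.span_submodule[OF BbM]] by blast
    have "\<psi> (r \<odot>\<^bsub>M\<^esub> b) = \<psi> z" using z(2) mod_homD(3)[OF \<psi>h r(1) bM] by simp
    then have "r \<odot>\<^bsub>M\<^esub> b = z" using inj_onD[OF \<psi>i _ _ zM] r(1) bM by simp
    then have "b \<in> PM.rank_closure (B - {b})" using z(1) r(1,2) bM by (auto simp: PM.rank_closure_def)
    then show False using B(1) b by (simp add: PM.rank.independent_def)
  qed
  then have ind: "PM.rank.independent (\<psi> ` B)"
    using mod_homD(1)[OF \<psi>h] BM by (auto simp: PM.rank.independent_def)
  have "card (\<psi> ` B) = card B" using inj_on_subset[OF \<psi>i BM] by (rule card_image)
  then have "PM.rank_closure (\<psi> ` B) = carrier M"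
    using PM.rank.independent_spans_if_card_eq[OF \<open>finite B\<close> B ind] \<open>finite B\<close> by simp
  moreover have "u f \<in> carrier M" using mod_homD(1)[OF uh] f by simp
  ultimately obtain r where r: "r \<in> carrier R" "r \<notin> P" "r \<odot>\<^bsub>M\<^esub> u f \<in> mod_span R M (\<psi> ` B)"
    by (auto simp: PM.rank_closure_def)
  have "mod_span R M (\<psi> ` B) \<subseteq> \<psi> ` carrier M"
    using BM by (intro span_minimal[OF image_submodule[OF M M \<psi>h PM.carrier_is_submodule]]) auto
  then obtain x where x: "x \<in> carrier M" "r \<odot>\<^bsub>M\<^esub> u f = \<psi> x" using r(3) by blast
  have "u (r \<odot>\<^bsub>?DD\<^esub> f) = u (canonical_map R E M x)"
    using x mod_homD(3)[OF uh r(1), of f] f by (simp add: \<psi>_def)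
  moreover have "r \<odot>\<^bsub>?DD\<^esub> f \<in> mod_hom R ?D E" using DD.smult_closed[OF r(1), of f] f by simp
  ultimately have eq: "r \<odot>\<^bsub>?DD\<^esub> f = canonical_map R E M x" by (rule inj_onD[OF ui _ _ cD[OF x(1)]])
  have "r \<odot>\<^bsub>E\<^esub> f n = n x" if n: "n \<in> mod_hom R M E" for n
    using fun_cong[OF eq, of n] n x(1) by (simp add: canonical_map_apply)
  then show thesis using that r(1,2) x(1) by blast
qed

section \<open>Modules that contain their bidual\<close>

text \<open>A counterexample yields an ideal \<open>I\<close> maximal among those with \<open>M\<^sub>I\<close> not reflexive. For \<open>a\<close> outside \<open>I\<close> the
  elements of \<open>M\<^sub>I\<close> killed by \<open>a\<close> then form a reflexive module, which allows division by \<open>a\<close>.\<close>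

lemma reflexive_if_bidual_embeds:
  assumes M: "module R M" and u: "u \<in> mod_mono R (matlis_bidual R E M) M"
  shows "matlis_reflexive R E M"
proof -
  let ?M = "\<lambda>I. annihilated R I M"
  let ?bad = "{I. ideal I R \<and> \<not> matlis_reflexive R E (?M I)}"
  have "?bad = {}"
  proof (rule ccontr)
    assume "?bad \<noteq> {}"
    moreover have "\<Union>C \<in> ?bad" if ne: "C \<noteq> {}" and ch: "subset.chain ?bad C" for C
    proof -
      have "C \<subseteq> ?bad" using ch by (simp add: subset_chain_def)
      moreover have "\<Union>C \<in> C"
        using ideal_chain_is_trivial[OF ne] ch by (auto simp: subset_chain_def)
      ultimately show ?thesis by blast
    qed
    ultimately obtain I where I: "ideal I R" "\<not> matlis_reflexive R E (?M I)"
      and max: "\<And>J. J \<in> ?bad \<Longrightarrow> I \<subseteq> J \<Longrightarrow> J = I"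
      using subset_Zorn_nonempty[of ?bad] by blast
    interpret I: ideal I R by (rule I(1))
    have IR: "I \<subseteq> carrier R" by (rule I.a_subset)
    have MI: "module R (?M I)" by (rule annihilated_module[OF M IR])
    interpret MI: module R "?M I" by (rule MI)
    have kill: "r \<odot>\<^bsub>?M I\<^esub> x = \<zero>\<^bsub>?M I\<^esub>" if "r \<in> I" "x \<in> carrier (?M I)" for r x
      using that by (simp add: in_carrier_annihilated)
    have step: "matlis_reflexive R E (annihilated R {a} (?M I))" if a: "a \<in> carrier R" "a \<notin> I" for a
    proof (rule ccontr)
      let ?J = "Idl (insert a I)"
      have aI: "insert a I \<subseteq> carrier R" using a IR by simp
      assume "\<not> ?thesis"
      then have "?J \<in> ?bad"
        using genideal_ideal[OF aI] by (simp add: annihilated_insert annihilated_genideal[OF M aI])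
      moreover have "insert a I \<subseteq> ?J" by (rule genideal_self[OF aI])
      ultimately show False using max[of ?J] a(2) by blast
    qed
    obtain f where f: "f \<in> mod_hom R (Hom_module R (?M I) E) E"
      and nf: "\<And>x. x \<in> carrier (?M I) \<Longrightarrow> \<exists>n\<in>mod_hom R (?M I) E. f n \<noteq> n x"
      using I(2) reflexiveI[OF MI] by blast
    have nf': False if "x \<in> carrier (?M I)" "\<And>n. n \<in> mod_hom R (?M I) E \<Longrightarrow> f n = n x" for x
      using nf that by blast
    note fE = mod_homD(1)[OF f, unfolded carrier_Hom_module]
    have killf: "r \<odot>\<^bsub>E\<^esub> f n = \<zero>\<^bsub>E\<^esub>" if "r \<in> I" "n \<in> mod_hom R (?M I) E" for r n
      using bidual_killed[OF MI f that(2), of r] kill[OF that(1)] that(1) IR by blast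
    have n0: "n \<zero>\<^bsub>?M I\<^esub> = \<zero>\<^bsub>E\<^esub>" if "n \<in> mod_hom R (?M I) E" for n
      by (rule mod_hom_zero[OF MI module_E that])
    \<comment> \<open>If \<open>a b\<close> kills \<open>f\<close>, then first \<open>b f\<close> and next \<open>f\<close> itself is an evaluation.\<close>
    have "primeideal I R"
    proof (rule primeidealI[OF I(1) is_cring])
      show "carrier R \<noteq> I"
      proof
        assume "carrier R = I"
        then have "f n = n \<zero>\<^bsub>?M I\<^esub>" if "n \<in> mod_hom R (?M I) E" for n
          using killf[of \<one> n] that n0[OF that] fE[OF that] by auto
        then show False by (rule nf'[OF MI.M.zero_closed])
      qed
      show "a \<in> I \<or> b \<in> I" if ab: "a \<in> carrier R" "b \<in> carrier R" "a \<otimes> b \<in> I" for a b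
      proof (rule ccontr)
        assume "\<not> (a \<in> I \<or> b \<in> I)"
        then have na: "a \<notin> I" and nb: "b \<notin> I" by auto
        let ?D = "Hom_module R (?M I) E"
        interpret D: module R ?D by (rule Hom_module_is_module[OF MI module_E])
        interpret DD: module R "Hom_module R ?D E" by (rule Hom_module_is_module[OF D.module_axioms module_E])
        let ?g = "b \<odot>\<^bsub>Hom_module R ?D E\<^esub> f"
        have g: "?g \<in> mod_hom R ?D E" using DD.smult_closed[OF ab(2), of f] f by simp
        have "a \<odot>\<^bsub>E\<^esub> ?g n = \<zero>\<^bsub>E\<^esub>" if "n \<in> mod_hom R (?M I) E" for n
          using killf[OF ab(3) that] that ab fE[OF that] by (simp add: E.smult_assoc1)
        then obtain x where x: "x \<in> carrier (?M I)" "\<And>n. n \<in> mod_hom R (?M I) E \<Longrightarrow> ?g n = n x"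
          using killed_by_reflexive[OF MI ab(1) step[OF ab(1) na] g] by blast
        have "b \<odot>\<^bsub>E\<^esub> f n = n x" if "n \<in> mod_hom R (?M I) E" for n
          using x(2)[OF that] that by simp
        then obtain y where "y \<in> carrier (?M I)" "\<And>n. n \<in> mod_hom R (?M I) E \<Longrightarrow> f n = n y"
          using divide_evaluation[OF MI ab(2) step[OF ab(2) nb] f x(1)] by blast
        then show False by (rule nf')
      qed
    qed
    then have PM: "prime_annihilated_module R (?M I) I"
      using kill by (intro prime_annihilated_module.intro MI prime_annihilated_module_axioms.intro)
    obtain v where v: "v \<in> mod_mono R (matlis_bidual R E (?M I)) (?M I)"
      using bidual_embedding_annihilated[OF M IR u] by blast
    obtain r x where r: "r \<in> carrier R" "r \<notin> I" and x: "x \<in> carrier (?M I)"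
      and rf: "\<And>n. n \<in> mod_hom R (?M I) E \<Longrightarrow> r \<odot>\<^bsub>E\<^esub> f n = n x"
      using cokernel_torsion[OF PM v f] by blast
    obtain y where "y \<in> carrier (?M I)" "\<And>n. n \<in> mod_hom R (?M I) E \<Longrightarrow> f n = n y"
      using divide_evaluation[OF MI r(1) step[OF r] f x rf] by blast
    then show False by (rule nf')
  qed
  moreover have "ideal {\<zero>} R" by (rule zeroideal)
  ultimately have "matlis_reflexive R E (?M {\<zero>})" by blast
  moreover have "?M {\<zero>} = M"
  proof -
    interpret M: module R M by (rule M)
    have "{x \<in> carrier M. \<forall>r\<in>{\<zero>}. r \<odot>\<^bsub>M\<^esub> x = \<zero>\<^bsub>M\<^esub>} = carrier M" by auto
    then show ?thesis by (simp add: annihilated_def)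
  qed
  ultimately show ?thesis by simp
qed

end

theorem mainTheorem3:
  fixes R :: "('r, 'c) ring_scheme"
    and \<mm> :: "'r set"
    and E :: "('r, 'e, 'd) module_scheme"
    and M :: "('r, 'm, 'f) module_scheme"
  assumes "noetherian_local_ring R \<mm>"
    and "injective_hull R (residue_module R \<mm>) E"
    and "module R M"
    and "(\<exists>u. u \<in> mod_mono R (matlis_bidual R E M) M) \<or>
      (\<exists>p. p \<in> mod_epi R M (matlis_bidual R E M))"
  shows "matlis_reflexive R E M"
proof -
  interpret matlis_duality R \<mm> E
    using assms(1,2) by (intro matlis_duality.intro matlis_duality_axioms.intro)
  show ?thesis
    using assms(4)
  proof
    assume "\<exists>u. u \<in> mod_mono R (matlis_bidual R E M) M"
    then show ?thesis using reflexive_if_bidual_embeds[OF assms(3)] by blast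
  next
    assume "\<exists>p. p \<in> mod_epi R M (matlis_bidual R E M)"
    then obtain u where "u \<in> mod_mono R (matlis_bidual R E (matlis_dual R E M)) (matlis_dual R E M)"
      using dual_mono_of_epi[OF assms(3)] by blast
    then have "matlis_reflexive R E (matlis_dual R E M)"
      by (rule reflexive_if_bidual_embeds[OF Hom_module_is_module[OF assms(3) module_E]])
    then show ?thesis by (rule reflexive_if_dual_reflexive[OF assms(3)])
  qed
qed

end
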